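(* Assume that $D$ is a step function defined with $K$ discontinuities, supposed to be part of the input. Suppose moreover that $\nu=0$. Then for each of the two problems P$^{\max}_{\text{no return}}$ and P$^{\mathrm{ave}}_{\text{no return}}$, there is an algorithm computing an optimal solution in time $O(K^2S)$.
   Context: Data: a positive integer $S$ (number of shuttles), a capacity $C\geq 0$, a period length $T$, a loading rate $\nu\geq 0$, and a nondecreasing upper semicontinuous function $D:[0,T]\to\mathbb{R}_+$ with $D(T)>0$ (cumulative demand). A step function is a finite linear combination of indicator functions of intervals. Pseudo-inverses of $D$: for $y\in[0,D(T)]$, $\tau(y)=\inf\{t\in[0,T]: D(t)>y\}$ if $y<D(T)$ and $\tau(D(T))=T$; $\bar\tau(y)=\inf\{t\in[0,T]: D(t)\geq y\}$. Problems P$^{\max}_{\text{no return}}$ and P$^{\mathrm{ave}}_{\text{no return}}$: over nonnegative reals $\boldsymbol d=(d_1,\dots,d_S)$, $\boldsymbol y=(y_1,\dots,y_S)$, with $y_0=0$, minimize respectively $$g^{\max}(\boldsymbol d,\boldsymbol y)=\max_{j:\,y_j>y_{j-1}}\big(d_j-\tau(y_{j-1})\big),\qquad g^{\mathrm{ave}}(\boldsymbol d,\boldsymbol y)=\frac{1}{D(T)}\sum_{j=1}^S\int_{y_{j-1}}^{y_j}\big(d_j-\bar\tau(y)\big)\,dy$$ subject to: (i) $y_j-y_{j-1}\leq C$ for $j=1,\dots,S$; (ii) $y_{j-1}\leq y_j$ for $j=1,\dots,S$; (iii) $d_{j-1}\leq d_j$ for $j=2,\dots,S$; (iv) $y_S=D(T)$;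 (v) $\bar\tau(y_j)+\nu(y_j-y_{j-1})\leq d_j$ for $j=1,\dots,S$. These problems are feasible if and only if $CS\geq D(T)$; when infeasible there is nothing to compute. Computational model: the following operations take constant time: evaluation of $D(t)$ for any $t\in[0,T]$; integration of $D$ between two values; evaluation of $\tau(y)$ and $\bar\tau(y)$ for any $y$; evaluation of $\sup\{y:\bar\tau(y)+\nu y\leq\alpha\}$ for any $\alpha\in\mathbb{R}_+$. The quantities $C$, $T$ and the total demand $D(T)$ are constants of the computational model (the constant hidden in the $O$-notation may depend on them), whereas the discontinuities of $D$ are part of the input, so that the complexity is expressed in terms of $K$ and $S$. *)

theory Defs
  imports "HOL-Analysis.Analysis"
begin

section \<open>The shuttle problems\<close>

definition step_function_on :: "real set \<Rightarrow> (real \<Rightarrow> real) \<Rightarrow> bool" where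
  "step_function_on X f \<longleftrightarrow>
     (\<exists>(n::nat) a I. (\<forall>i<n. is_interval (I i)) \<and>
        (\<forall>t\<in>X. f t = (\<Sum>i<n. a i * indicator (I i) t)))"

definition upper_semicontinuous_on :: "real set \<Rightarrow> (real \<Rightarrow> real) \<Rightarrow> bool" where
  "upper_semicontinuous_on X f \<longleftrightarrow>
     (\<forall>t\<in>X. \<forall>a>f t. eventually (\<lambda>s. f s < a) (at t within X))"

definition discontinuities :: "real \<Rightarrow> (real \<Rightarrow> real) \<Rightarrow> real set" where
  "discontinuities T D = {t \<in> {0..T}. \<not> continuous (at t within {0..T}) D}"

(* Only the restriction of the demand D to {0..T} is meaningful; its values elsewhere
   are arbitrary and nothing below depends on them. *)
definition shuttle_data :: "nat \<Rightarrow> real \<Rightarrow> real \<Rightarrow> real \<Rightarrow> (real \<Rightarrow> real) \<Rightarrow> bool" where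
  "shuttle_data S C T \<nu> D \<longleftrightarrow>
     S > 0 \<and> C \<ge> 0 \<and> T \<ge> 0 \<and> \<nu> \<ge> 0 \<and>
     (\<forall>t\<in>{0..T}. D t \<ge> 0) \<and> mono_on {0..T} D \<and> upper_semicontinuous_on {0..T} D \<and> D T > 0"

definition tau :: "real \<Rightarrow> (real \<Rightarrow> real) \<Rightarrow> real \<Rightarrow> real" where
  "tau T D y = (if y < D T then Inf {t \<in> {0..T}. D t > y} else T)"

definition tau_bar :: "real \<Rightarrow> (real \<Rightarrow> real) \<Rightarrow> real \<Rightarrow> real" where
  "tau_bar T D y = Inf {t \<in> {0..T}. D t \<ge> y}"

(* A solution is a pair of families d, y indexed by {1..S}, together with y 0 = 0;
   d 0 and all entries beyond S are irrelevant. *)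
definition feasible ::
  "nat \<Rightarrow> real \<Rightarrow> real \<Rightarrow> real \<Rightarrow> (real \<Rightarrow> real) \<Rightarrow> (nat \<Rightarrow> real) \<Rightarrow> (nat \<Rightarrow> real) \<Rightarrow> bool" where
  "feasible S C T \<nu> D d y \<longleftrightarrow>
     y 0 = 0 \<and>
     (\<forall>j\<in>{1..S}. d j \<ge> 0 \<and> y j \<ge> 0) \<and>
     (\<forall>j\<in>{1..S}. y j - y (j - 1) \<le> C) \<and>
     (\<forall>j\<in>{1..S}. y (j - 1) \<le> y j) \<and>
     (\<forall>j\<in>{2..S}. d (j - 1) \<le> d j) \<and>
     y S = D T \<and>
     (\<forall>j\<in>{1..S}. tau_bar T D (y j) + \<nu> * (y j - y (j - 1)) \<le> d j)"

(* For feasible y the maximum is over a nonempty set, since y 0 = 0 < D T = y S. *)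
definition g_max ::
  "nat \<Rightarrow> real \<Rightarrow> (real \<Rightarrow> real) \<Rightarrow> (nat \<Rightarrow> real) \<Rightarrow> (nat \<Rightarrow> real) \<Rightarrow> real" where
  "g_max S T D d y = Max ((\<lambda>j. d j - tau T D (y (j - 1))) ` {j \<in> {1..S}. y j > y (j - 1)})"

definition g_ave ::
  "nat \<Rightarrow> real \<Rightarrow> (real \<Rightarrow> real) \<Rightarrow> (nat \<Rightarrow> real) \<Rightarrow> (nat \<Rightarrow> real) \<Rightarrow> real" where
  "g_ave S T D d y =
     1 / D T * (\<Sum>j=1..S. integral {y (j - 1)..y j} (\<lambda>u. d j - tau_bar T D u))"

definition optimal ::
  "(nat \<Rightarrow> real \<Rightarrow> (real \<Rightarrow> real) \<Rightarrow> (nat \<Rightarrow> real) \<Rightarrow> (nat \<Rightarrow> real) \<Rightarrow> real) \<Rightarrow>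
   nat \<Rightarrow> real \<Rightarrow> real \<Rightarrow> real \<Rightarrow> (real \<Rightarrow> real) \<Rightarrow> (nat \<Rightarrow> real) \<Rightarrow> (nat \<Rightarrow> real) \<Rightarrow> bool" where
  "optimal g S C T \<nu> D d y \<longleftrightarrow>
     feasible S C T \<nu> D d y \<and>
     (\<forall>d' y'. feasible S C T \<nu> D d' y' \<longrightarrow> g S T D d y \<le> g S T D d' y')"


section \<open>The computational model\<close>

text \<open>
  The model is a real RAM, presented as a small imperative language. The memory consists of named
  arrays with entries in the naturals and named arrays with entries in the reals; a program
  mentions finitely many names. A scalar variable is entry 0 of its array. Exact
  arithmetic, comparisons, indirect addressing and the queries about the demand function are the
  elementary operations, each of unit cost; there is no rounding of reals to integers. The only
  constants that a program may contain are natural numbers.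
\<close>

record demand_oracle =
  eval_query :: "real \<Rightarrow> real"
  integral_query :: "real \<Rightarrow> real \<Rightarrow> real"
  tau_query :: "real \<Rightarrow> real"
  tau_bar_query :: "real \<Rightarrow> real"
  sup_query :: "real \<Rightarrow> real"

(* Queries outside their domain are answered by 0, so that they reveal nothing about D. *)
definition oracle_of :: "real \<Rightarrow> real \<Rightarrow> (real \<Rightarrow> real) \<Rightarrow> demand_oracle" where
  "oracle_of T \<nu> D =
     \<lparr> eval_query = (\<lambda>t. if t \<in> {0..T} then D t else 0),
       integral_query = (\<lambda>a b. if a \<in> {0..T} \<and> b \<in> {0..T} then integral {a..b} D else 0),
       tau_query = (\<lambda>y. if y \<in> {0..D T} then tau T D y else 0),
       tau_bar_query = (\<lambda>y. if y \<in> {0..D T} then tau_bar T D y else 0),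
       sup_query = (\<lambda>\<alpha>. if \<alpha> \<ge> 0
          then Sup {y \<in> {0..D T}. tau_bar T D y + \<nu> * y \<le> \<alpha>} else 0) \<rparr>"

type_synonym vname = string

record store =
  nats :: "vname \<Rightarrow> nat \<Rightarrow> nat"
  reals :: "vname \<Rightarrow> nat \<Rightarrow> real"

datatype nexp =
    NLit nat | NGet vname nexp
  | NAdd nexp nexp | NSub nexp nexp | NMul nexp nexp

datatype rexp =
    RLit nat | RGet vname nexp
  | RAdd rexp rexp | RSub rexp rexp | RMul rexp rexp | RDiv rexp rexp
  | QEval rexp | QIntegral rexp rexp | QTau rexp | QTauBar rexp | QSup rexp

datatype bexp = NLess nexp nexp | RLess rexp rexp | Neg bexp | Conj bexp bexp

datatype com =
    Skip
  | NSet vname nexp nexp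
  | RSet vname nexp rexp
  | Seq com com
  | Cond bexp com com
  | While bexp com

primrec nval :: "store \<Rightarrow> nexp \<Rightarrow> nat" where
  "nval s (NLit n) = n"
| "nval s (NGet x e) = nats s x (nval s e)"
| "nval s (NAdd e f) = nval s e + nval s f"
| "nval s (NSub e f) = nval s e - nval s f"
| "nval s (NMul e f) = nval s e * nval s f"

primrec rval :: "demand_oracle \<Rightarrow> store \<Rightarrow> rexp \<Rightarrow> real" where
  "rval q s (RLit n) = real n"
| "rval q s (RGet x e) = reals s x (nval s e)"
| "rval q s (RAdd e f) = rval q s e + rval q s f"
| "rval q s (RSub e f) = rval q s e - rval q s f"
| "rval q s (RMul e f) = rval q s e * rval q s f"
| "rval q s (RDiv e f) = rval q s e / rval q s f"
| "rval q s (QEval e) = eval_query q (rval q s e)"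
| "rval q s (QIntegral e f) = integral_query q (rval q s e) (rval q s f)"
| "rval q s (QTau e) = tau_query q (rval q s e)"
| "rval q s (QTauBar e) = tau_bar_query q (rval q s e)"
| "rval q s (QSup e) = sup_query q (rval q s e)"

primrec bval :: "demand_oracle \<Rightarrow> store \<Rightarrow> bexp \<Rightarrow> bool" where
  "bval q s (NLess e f) \<longleftrightarrow> nval s e < nval s f"
| "bval q s (RLess e f) \<longleftrightarrow> rval q s e < rval q s f"
| "bval q s (Neg b) \<longleftrightarrow> \<not> bval q s b"
| "bval q s (Conj b c) \<longleftrightarrow> bval q s b \<and> bval q s c"

primrec ncost :: "nexp \<Rightarrow> nat" where
  "ncost (NLit n) = 1"
| "ncost (NGet x e) = ncost e + 1"
| "ncost (NAdd e f) = ncost e + ncost f + 1"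
| "ncost (NSub e f) = ncost e + ncost f + 1"
| "ncost (NMul e f) = ncost e + ncost f + 1"

primrec rcost :: "rexp \<Rightarrow> nat" where
  "rcost (RLit n) = 1"
| "rcost (RGet x e) = ncost e + 1"
| "rcost (RAdd e f) = rcost e + rcost f + 1"
| "rcost (RSub e f) = rcost e + rcost f + 1"
| "rcost (RMul e f) = rcost e + rcost f + 1"
| "rcost (RDiv e f) = rcost e + rcost f + 1"
| "rcost (QEval e) = rcost e + 1"
| "rcost (QIntegral e f) = rcost e + rcost f + 1"
| "rcost (QTau e) = rcost e + 1"
| "rcost (QTauBar e) = rcost e + 1"
| "rcost (QSup e) = rcost e + 1"

primrec bcost :: "bexp \<Rightarrow> nat" where
  "bcost (NLess e f) = ncost e + ncost f + 1"
| "bcost (RLess e f) = rcost e + rcost f + 1"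
| "bcost (Neg b) = bcost b + 1"
| "bcost (Conj b c) = bcost b + bcost c + 1"

definition set_nat :: "vname \<Rightarrow> nat \<Rightarrow> nat \<Rightarrow> store \<Rightarrow> store" where
  "set_nat x i v s = s\<lparr>nats := (nats s)(x := (nats s x)(i := v))\<rparr>"

definition set_real :: "vname \<Rightarrow> nat \<Rightarrow> real \<Rightarrow> store \<Rightarrow> store" where
  "set_real x i v s = s\<lparr>reals := (reals s)(x := (reals s x)(i := v))\<rparr>"

(* exec q c s n s': with demand queries answered by q, the program c started in store s
   terminates in store s' after time n. *)
inductive exec :: "demand_oracle \<Rightarrow> com \<Rightarrow> store \<Rightarrow> nat \<Rightarrow> store \<Rightarrow> bool"
  for q :: demand_oracle where
  Skip: "exec q Skip s 1 s"
| NSet: "exec q (NSet x e f) s (ncost e + ncost f + 1) (set_nat x (nval s e) (nval s f) s)"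
| RSet: "exec q (RSet x e f) s (ncost e + rcost f + 1) (set_real x (nval s e) (rval q s f) s)"
| Seq: "exec q c1 s1 n1 s2 \<Longrightarrow> exec q c2 s2 n2 s3 \<Longrightarrow> exec q (Seq c1 c2) s1 (n1 + n2) s3"
| CondTrue: "bval q s b \<Longrightarrow> exec q c1 s n t \<Longrightarrow> exec q (Cond b c1 c2) s (bcost b + n + 1) t"
| CondFalse: "\<not> bval q s b \<Longrightarrow> exec q c2 s n t \<Longrightarrow> exec q (Cond b c1 c2) s (bcost b + n + 1) t"
| WhileFalse: "\<not> bval q s b \<Longrightarrow> exec q (While b c) s (bcost b + 1) s"
| WhileTrue: "bval q s1 b \<Longrightarrow> exec q c s1 n1 s2 \<Longrightarrow> exec q (While b c) s2 n2 s3 \<Longrightarrow>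
    exec q (While b c) s1 (bcost b + n1 + n2 + 1) s3"

inductive_cases exec_SkipE: "exec q Skip s n t"
inductive_cases exec_NSetE: "exec q (NSet x e f) s n t"
inductive_cases exec_RSetE: "exec q (RSet x e f) s n t"
inductive_cases exec_SeqE: "exec q (Seq c1 c2) s n t"
inductive_cases exec_CondE: "exec q (Cond b c1 c2) s n t"
inductive_cases exec_WhileE: "exec q (While b c) s n t"

lemma exec_deterministic:
  "exec q c s n t \<Longrightarrow> exec q c s n' t' \<Longrightarrow> n' = n \<and> t' = t"
proof (induction arbitrary: n' t' rule: exec.induct)
  case (Skip s)
  then show ?case by (rule exec_SkipE) simp
next
  case (NSet x e f s)
  then show ?case by (rule exec_NSetE) simp
next
  case (RSet x e f s)
  then show ?case by (rule exec_RSetE) simp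
next
  case (Seq c1 s1 n1 s2 c2 n2 s3)
  from Seq.prems show ?case
  proof (rule exec_SeqE)
    fix m1 m2 s2'
    assume *: "n' = m1 + m2" "exec q c1 s1 m1 s2'" "exec q c2 s2' m2 t'"
    from Seq.IH(1)[OF *(2)] have "m1 = n1" "s2' = s2" by simp_all
    with Seq.IH(2)[of m2 t'] * show ?case by simp
  qed
next
  case (CondTrue s b c1 n t c2)
  from CondTrue.prems show ?case
    by (rule exec_CondE) (use CondTrue.hyps in \<open>auto dest: CondTrue.IH\<close>)
next
  case (CondFalse s b c2 n t c1)
  from CondFalse.prems show ?case
    by (rule exec_CondE) (use CondFalse.hyps in \<open>auto dest: CondFalse.IH\<close>)
next
  case (WhileFalse s b c)
  from WhileFalse.prems show ?case
    by (rule exec_WhileE) (use WhileFalse.hyps in simp_all)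
next
  case (WhileTrue s1 b c n1 s2 n2 s3)
  from WhileTrue.prems show ?case
  proof (rule exec_WhileE)
    assume "\<not> bval q s1 b"
    with WhileTrue.hyps(1) show ?case by contradiction
  next
    fix m1 s2' m2
    assume *: "n' = Suc (bcost b + m1 + m2)" "exec q c s1 m1 s2'" "exec q (While b c) s2' m2 t'"
    from WhileTrue.IH(1)[OF *(2)] have "m1 = n1" "s2' = s2" by simp_all
    with WhileTrue.IH(2)[of m2 t'] * show ?case by simp
  qed
qed

definition input_store :: "nat \<Rightarrow> real \<Rightarrow> real \<Rightarrow> real \<Rightarrow> (real \<Rightarrow> real) \<Rightarrow> store" where
  "input_store S C T \<nu> D =
     (let ts = sorted_list_of_set (discontinuities T D) in
      \<lparr> nats = (\<lambda>x i.
          if x = ''S'' \<and> i = 0 then S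
          else if x = ''K'' \<and> i = 0 then length ts
          else 0),
        reals = (\<lambda>x i.
          if x = ''C'' \<and> i = 0 then C
          else if x = ''T'' \<and> i = 0 then T
          else if x = ''nu'' \<and> i = 0 then \<nu>
          else if x = ''DT'' \<and> i = 0 then D T
          else if x = ''disc'' \<and> i < length ts then ts ! i
          else 0) \<rparr>)"

(* The result (d, y) is read off the real arrays ''d'' and ''y'', with entry j holding the
   value of index j. *)
definition computes_optimum_within ::
  "com \<Rightarrow> (nat \<Rightarrow> real \<Rightarrow> (real \<Rightarrow> real) \<Rightarrow> (nat \<Rightarrow> real) \<Rightarrow> (nat \<Rightarrow> real) \<Rightarrow> real) \<Rightarrow>
   nat \<Rightarrow> real \<Rightarrow> real \<Rightarrow> real \<Rightarrow> (real \<Rightarrow> real) \<Rightarrow> nat \<Rightarrow> bool" where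
  "computes_optimum_within p g S C T \<nu> D bound \<longleftrightarrow>
     (\<exists>n s. exec (oracle_of T \<nu> D) p (input_store S C T \<nu> D) n s \<and> n \<le> bound \<and>
        optimal g S C T \<nu> D (reals s ''d'') (reals s ''y''))"

end

theory Submission
  imports Defs
begin

text \<open>
  Without loading time a solution is determined by the load levels \<open>0 = y 0 \<le> \<dots> \<le> y S = D T\<close>, with
  increments of at most \<open>C\<close>: shuttle \<open>j\<close> may leave at the time \<open>tau_bar T D (y j)\<close>, and leaving later
  never helps. The solution remains optimal if every shuttle takes along whoever has arrived by its
  departure, as far as the capacity allows. This turns \<open>y\<close> into a staircase that is at least as high
  (\<open>staircase_ge\<close>) and costs no more (\<open>staircase_max_value_le\<close>, \<open>staircase_ave_value_le\<close>): for the
  maximum, because no shuttle leaves later and no first passenger of a shuttle arrives earlier; for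
  the average, by summation by parts.

  Each level of a staircase is a value of \<open>D\<close> or the preceding level plus \<open>C\<close>. As \<open>D\<close> is a step
  function, its values at departure times are \<open>D 0\<close> or values at discontinuities, so all levels belong
  to the grid of the points \<open>min (D T) (v + k C)\<close>, where \<open>v\<close> is 0 or such a value and \<open>k\<close> is bounded by
  \<open>D T / C\<close>, rounded up (\<open>staircase_in_grid\<close>). The grid has \<open>O(K)\<close> points, and finding the best path with \<open>S\<close> steps
  is a shortest path problem in a layered graph with \<open>O(K\<^sup>2 S)\<close> edges, with costs that are added up for
  the average and combined by \<open>max\<close> for the maximum. Dynamic programming treats both cases alike,
  because both ways of combining costs are monotone (\<open>table_le_path_value\<close>, \<open>trace_value\<close>).

  The program therefore generates the grid, fills the table of best costs and predecessors, and reads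
  off the path backwards. Its correctness and its running time are established together with loop
  invariants, in a small calculus of total correctness with time bounds. The resulting time bound is a
  constant times \<open>M\<^sup>2 S\<close>, where \<open>M\<close> is the number of grid points.
\<close>

section \<open>Step demands and their pseudo-inverses\<close>

locale step_demand =
  fixes T :: real and D :: "real \<Rightarrow> real"
  assumes T_nonneg: "0 \<le> T"
    and D_nonneg: "t \<in> {0..T} \<Longrightarrow> 0 \<le> D t"
    and D_mono: "mono_on {0..T} D"
    and D_usc: "upper_semicontinuous_on {0..T} D"
    and D_step: "step_function_on {0..T} D"
begin

lemma D_le: "0 \<le> s \<Longrightarrow> s \<le> t \<Longrightarrow> t \<le> T \<Longrightarrow> D s \<le> D t"
  using D_mono by (auto simp: mono_on_def)

lemma D_le_DT: "t \<in> {0..T} \<Longrightarrow> D t \<le> D T"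
  using D_le by auto

lemma DT_nonneg: "0 \<le> D T"
  using D_nonneg T_nonneg by auto

lemma finite_levels: "finite (D ` {0..T})"
proof -
  obtain n :: nat and a :: "nat \<Rightarrow> real" and I
    where eq: "\<And>t. t \<in> {0..T} \<Longrightarrow> D t = (\<Sum>i<n. a i * indicator (I i) t)"
    using D_step unfolding step_function_on_def by auto
  \<comment> \<open>a value of \<open>D\<close> is determined by the set of intervals that contain the argument\<close>
  have levels: "D t = (\<Sum>i<n. a i * indicator {i. i < n \<and> t \<in> I i} i)" if "t \<in> {0..T}" for t
    unfolding eq[OF that] by (intro sum.cong) (auto simp: indicator_def)
  have "D ` {0..T} \<subseteq> (\<lambda>B. \<Sum>i<n. a i * indicator B i) ` Pow {..<n}"
  proof (rule image_subsetI)
    fix t assume "t \<in> {0..T}"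
    then show "D t \<in> (\<lambda>B. \<Sum>i<n. a i * indicator B i) ` Pow {..<n}"
      by (intro image_eqI[of _ _ "{i. i < n \<and> t \<in> I i}"] levels) auto
  qed
  then show ?thesis
    by (rule finite_subset) simp
qed

text \<open>
  Monotonicity keeps \<open>D\<close> from dropping on either side of \<open>t\<close>, upper semicontinuity keeps it from
  rising, and only the left limit could still lie below \<open>D t\<close>.
\<close>

lemma continuous_if_constant_before:
  assumes "0 \<le> s" "s < t" "t \<le> T" "D s = D t"
  shows "continuous (at t within {0..T}) D"
proof -
  have "eventually (\<lambda>u. b < D u) (at t within {0..T})" if "b < D t" for b
  proof -
    have "b < D u" if "u \<in> {0..T} \<inter> {s<..}" for u
      using \<open>b < D t\<close> \<open>D s = D t\<close> D_le[of s u] that assms(1) by auto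
    moreover have "eventually (\<lambda>u. u \<in> {s<..}) (at t within {0..T})"
      using assms(2) by (intro topological_tendstoD[OF tendsto_ident_at]) auto
    ultimately show ?thesis
      by (auto simp: eventually_at_filter elim!: eventually_mono)
  qed
  moreover have "eventually (\<lambda>u. D u < b) (at t within {0..T})" if "D t < b" for b
    using D_usc assms that unfolding upper_semicontinuous_on_def by auto
  ultimately have "(D \<longlongrightarrow> D t) (at t within {0..T})"
    by (intro order_tendstoI)
  then show ?thesis
    by (simp add: continuous_within)
qed

text \<open>
  Two discontinuities cannot share a value of \<open>D\<close>, since \<open>D\<close> would be constant between them. Hence
  there are no more discontinuities than values. This guarantees that the sorted list of
  discontinuities in the input is complete: for an infinite set it would be empty.
\<close>

lemma finite_discontinuities: "finite (discontinuities T D)"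
proof (rule finite_imageD)
  show "finite (D ` discontinuities T D)"
    by (rule finite_subset[OF _ finite_levels]) (auto simp: discontinuities_def)
  show "inj_on D (discontinuities T D)"
  proof (rule linorder_inj_onI')
    fix s t assume "s \<in> discontinuities T D" "t \<in> discontinuities T D" "s < t"
    then show "D s \<noteq> D t"
      using continuous_if_constant_before[of s t] by (auto simp: discontinuities_def)
  qed
qed

lemma constant_near_continuity:
  assumes "t \<in> {0..T}" "continuous (at t within {0..T}) D"
  shows "eventually (\<lambda>s. s \<in> {0..T} \<longrightarrow> D s = D t) (nhds t)"
proof -
  have "open (- (D ` {0..T} - {D t}))"
    using finite_levels by (intro open_Compl finite_imp_closed) auto
  then have "eventually (\<lambda>s. D s \<in> - (D ` {0..T} - {D t})) (at t within {0..T})"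
    using assms(2) by (intro topological_tendstoD[where l = "D t"]) (auto simp: continuous_within)
  then show ?thesis
    unfolding eventually_at_filter by eventually_elim auto
qed

context
  fixes y :: real
  assumes y_le: "y \<le> D T"
begin

lemma tau_bar_in: "tau_bar T D y \<in> {0..T}"
  unfolding tau_bar_def using y_le T_nonneg
  by (auto intro!: cInf_greatest cInf_lower bdd_belowI[of _ 0])

lemma tau_bar_least: "t \<in> {0..T} \<Longrightarrow> y \<le> D t \<Longrightarrow> tau_bar T D y \<le> t"
  unfolding tau_bar_def by (intro cInf_lower bdd_belowI[of _ 0]) auto

lemma below_tau_bar: "0 \<le> s \<Longrightarrow> s < tau_bar T D y \<Longrightarrow> D s < y"
  using tau_bar_least[of s] tau_bar_in by force

text \<open>
  The infimum that defines \<open>tau_bar\<close> is attained: if \<open>D\<close> were below \<open>y\<close> there, upper semicontinuity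
  would keep it below \<open>y\<close> a little longer.
\<close>

lemma level_tau_bar: "y \<le> D (tau_bar T D y)"
proof (rule ccontr)
  let ?t = "tau_bar T D y"
  assume "\<not> ?thesis"
  then have "eventually (\<lambda>s. D s < y) (at ?t within {0..T})"
    using D_usc tau_bar_in unfolding upper_semicontinuous_on_def by auto
  then obtain e where e: "e > 0" and near: "\<And>s. s \<in> {0..T} \<Longrightarrow> s \<noteq> ?t \<Longrightarrow> dist s ?t < e \<Longrightarrow> D s < y"
    unfolding eventually_at by auto
  have "?t + e \<le> s" if s: "s \<in> {t \<in> {0..T}. y \<le> D t}" for s
    using s near[of s] tau_bar_least[of s] \<open>\<not> y \<le> D ?t\<close> by (force simp: dist_real_def)
  then have "?t + e \<le> Inf {t \<in> {0..T}. y \<le> D t}"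
    using y_le T_nonneg by (intro cInf_greatest) auto
  then show False
    using e by (simp add: tau_bar_def)
qed

text \<open>
  Where a step function is continuous it is locally constant, so level \<open>y\<close> would already be reached
  earlier. It follows that the demand level at a departure time takes one of the values known from
  the input: \<open>D 0\<close> or \<open>D\<close> at a discontinuity.
\<close>

lemma tau_bar_breakpoint: "tau_bar T D y = 0 \<or> tau_bar T D y \<in> discontinuities T D"
proof (rule ccontr)
  let ?t = "tau_bar T D y"
  assume no: "\<not> ?thesis"
  then have pos: "0 < ?t" and cont: "continuous (at ?t within {0..T}) D"
    using tau_bar_in by (auto simp: discontinuities_def)
  obtain e where e: "e > 0" and const: "\<And>s. dist s ?t < e \<Longrightarrow> s \<in> {0..T} \<Longrightarrow> D s = D ?t"
    using constant_near_continuity[OF tau_bar_in cont] unfolding eventually_nhds_metric by auto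
  \<comment> \<open>a time before \<open>?t\<close> that is still nonnegative and still close enough\<close>
  define s where "s = max (?t / 2) (?t - e / 2)"
  have "0 \<le> s" "s < ?t" "dist s ?t < e"
    using pos e by (auto simp: s_def dist_real_def max_def)
  then have "D s = D ?t" "D s < y"
    using tau_bar_in by (auto intro!: const below_tau_bar)
  then show False
    using level_tau_bar by simp
qed

lemma level_tau_bar_le_DT: "D (tau_bar T D y) \<le> D T"
  using D_le_DT tau_bar_in by blast

end

lemma tau_bar_mono: "a \<le> b \<Longrightarrow> b \<le> D T \<Longrightarrow> tau_bar T D a \<le> tau_bar T D b"
  using tau_bar_least[of a "tau_bar T D b"] tau_bar_in[of b] level_tau_bar[of b] by simp

lemma tau_le_tau_bar: "a < b \<Longrightarrow> b \<le> D T \<Longrightarrow> tau T D a \<le> tau_bar T D b"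
  unfolding tau_def using level_tau_bar[of b] tau_bar_in[of b]
  by (auto intro!: cInf_lower bdd_belowI[of _ 0])

lemma tau_bar_le_tau: "a \<le> D T \<Longrightarrow> tau_bar T D a \<le> tau T D a"
proof (cases "a < D T")
  case True
  then have "tau T D a = Inf {t \<in> {0..T}. a < D t}"
    by (simp add: tau_def)
  also have "\<dots> \<ge> tau_bar T D a"
    using True T_nonneg by (intro cInf_greatest) (auto intro!: tau_bar_least)
  finally show ?thesis .
qed (use tau_bar_in[of a] in \<open>auto simp: tau_def\<close>)

lemma tau_mono: "a \<le> b \<Longrightarrow> b \<le> D T \<Longrightarrow> tau T D a \<le> tau T D b"
  using tau_le_tau_bar[of a b] tau_bar_le_tau[of b] by (cases "a = b") auto

end


section \<open>Staircase solutions\<close>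

text \<open>
  Shuttle \<open>j\<close> leaves as full as possible without postponing the departure: it takes everybody who has
  arrived by the time \<open>tau_bar T D (y j)\<close>, up to its capacity.
\<close>

primrec staircase :: "real \<Rightarrow> real \<Rightarrow> (real \<Rightarrow> real) \<Rightarrow> (nat \<Rightarrow> real) \<Rightarrow> nat \<Rightarrow> real" where
  "staircase C T D y 0 = 0"
| "staircase C T D y (Suc j) = min (D (tau_bar T D (y (Suc j)))) (staircase C T D y j + C)"

text \<open>
  Both objectives accumulate a cost along the path \<open>y 0, y 1, \<dots>\<close>; \<open>f v a b\<close> is the cost of a path
  that arrives at \<open>a\<close> with cost \<open>v\<close> and continues to \<open>b\<close>.
\<close>

primrec path_value ::
  "(real \<Rightarrow> real \<Rightarrow> real \<Rightarrow> real) \<Rightarrow> (nat \<Rightarrow> real) \<Rightarrow> nat \<Rightarrow> real" where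
  "path_value f y 0 = 0"
| "path_value f y (Suc j) = f (path_value f y j) (y j) (y (Suc j))"

text \<open>
  For the average, the integral of \<open>tau_bar\<close> and the factor \<open>1 / D T\<close> are the same for all solutions
  and are left out.
\<close>

definition ave_step :: "real \<Rightarrow> (real \<Rightarrow> real) \<Rightarrow> real \<Rightarrow> real \<Rightarrow> real \<Rightarrow> real" where
  "ave_step T D v a b = v + (b - a) * tau_bar T D b"

text \<open>
  Empty shuttles do not count in \<open>g_max\<close>. Here they need no special treatment: for \<open>a = b\<close> the second
  argument of \<open>max\<close> is at most 0, and paths start with cost 0.
\<close>

definition max_step :: "real \<Rightarrow> (real \<Rightarrow> real) \<Rightarrow> real \<Rightarrow> real \<Rightarrow> real \<Rightarrow> real" where
  "max_step T D v a b = max v (tau_bar T D b - tau T D a)"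

definition load_path :: "nat \<Rightarrow> real \<Rightarrow> real \<Rightarrow> (nat \<Rightarrow> real) \<Rightarrow> bool" where
  "load_path S C Y y \<longleftrightarrow> y 0 = 0 \<and> (\<forall>j<S. y j \<le> y (Suc j) \<and> y (Suc j) \<le> y j + C) \<and> y S = Y"

text \<open>
  Clamping at \<open>D T\<close> keeps every point inside the domain of the demand queries.
\<close>

definition grid :: "real \<Rightarrow> real \<Rightarrow> (real \<Rightarrow> real) \<Rightarrow> nat \<Rightarrow> real set" where
  "grid C T D N =
    {min (D T) (v + real k * C) | v k.
       v \<in> insert 0 (insert (D 0) (D ` discontinuities T D)) \<and> k \<le> N}"

lemma path_value_cong:
  "(\<And>i. i \<le> j \<Longrightarrow> y i = z i) \<Longrightarrow> path_value f y j = path_value f z j"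
  by (induction j) auto

text \<open>
  Summation by parts: with nondecreasing weights, raising the partial sums shifts increments to
  earlier, cheaper indices.
\<close>

lemma increments_weighted_le:
  fixes x z e :: "nat \<Rightarrow> real"
  assumes "x 0 = z 0" "\<And>j. j \<le> n \<Longrightarrow> x j \<le> z j" "\<And>j. Suc j < n \<Longrightarrow> e j \<le> e (Suc j)"
    and "0 < n"
  shows "(\<Sum>j<n. (z (Suc j) - z j) * e j) \<le>
    (\<Sum>j<n. (x (Suc j) - x j) * e j) + (z n - x n) * e (n - 1)"
  using assms(4) assms(2,3)
proof (induction n rule: nat_induct_non_zero)
  case 1
  then show ?case using assms(1) by (simp add: algebra_simps)
next
  case (Suc n)
  have "(z n - x n) * e (n - 1) \<le> (z n - x n) * e n"
    using Suc.prems(1)[of n] Suc.prems(2)[of "n - 1"] Suc.hyps by (intro mult_left_mono) auto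
  then show ?case using Suc by (simp add: algebra_simps)
qed

lemma load_path_mono:
  assumes "load_path S C Y y" "i \<le> j" "j \<le> S"
  shows "y i \<le> y j"
  using assms(2,3)
proof (induction j rule: dec_induct)
  case (step j)
  with assms(1) show ?case by (auto simp: load_path_def dest!: spec[of _ j])
qed simp

lemma load_path_bounds: "load_path S C Y y \<Longrightarrow> j \<le> S \<Longrightarrow> 0 \<le> y j \<and> y j \<le> Y"
  using load_path_mono[of S C Y y 0 j] load_path_mono[of S C Y y j S]
  by (auto simp: load_path_def)

context step_demand
begin

lemma feasible_load_path:
  assumes "feasible S C T \<nu> D d y" "S > 0"
  shows "load_path S C (D T) y"
  unfolding load_path_def
proof (intro conjI allI impI)
  fix j assume "j < S"
  then have "Suc j \<in> {1..S}" by simp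
  with assms(1) show "y j \<le> y (Suc j)" "y (Suc j) \<le> y j + C"
    unfolding feasible_def by (force dest!: bspec[of _ _ "Suc j"])+
qed (use assms in \<open>auto simp: feasible_def\<close>)

lemma load_path_feasible:
  assumes y: "load_path S C (D T) y"
    and d: "\<And>j. j \<in> {1..S} \<Longrightarrow> d j = tau_bar T D (y j)"
  shows "feasible S C T 0 D d y"
  unfolding feasible_def
proof (intro conjI ballI)
  fix j assume j: "j \<in> {1..S}"
  then have "y (j - 1) \<le> y j \<and> y j \<le> y (j - 1) + C"
    using y by (auto simp: load_path_def dest!: spec[of _ "j - 1"])
  then show "y (j - 1) \<le> y j" "y j - y (j - 1) \<le> C" by auto
  show "0 \<le> y j" "0 \<le> d j" "tau_bar T D (y j) + 0 * (y j - y (j - 1)) \<le> d j"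
    using j load_path_bounds[OF y, of j] tau_bar_in[of "y j"] d[of j] by auto
next
  fix j assume j: "j \<in> {2..S}"
  then show "d (j - 1) \<le> d j"
    using load_path_mono[OF y, of "j - 1" j] load_path_bounds[OF y, of j] d[of j]
    by (subst d) (auto intro!: tau_bar_mono)
qed (use y in \<open>auto simp: load_path_def\<close>)

context
  fixes S C y
  assumes y: "load_path S C (D T) y" and C_nonneg: "0 \<le> C"
begin

text \<open>
  Loading greedily for the same departure times never falls behind.
\<close>

lemma staircase_ge: "j \<le> S \<Longrightarrow> y j \<le> staircase C T D y j"
proof (induction j)
  case (Suc j)
  then have "y (Suc j) \<le> y j + C" "y j \<le> staircase C T D y j"
    using y by (auto simp: load_path_def)
  moreover have "y (Suc j) \<le> D (tau_bar T D (y (Suc j)))"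
    using Suc load_path_bounds[OF y] by (intro level_tau_bar) auto
  ultimately show ?case by simp
qed (use y in \<open>simp add: load_path_def\<close>)

lemma staircase_le_level:
  "0 < j \<Longrightarrow> staircase C T D y j \<le> D (tau_bar T D (y j))"
  by (cases j) auto

lemma staircase_path: "load_path S C (D T) (staircase C T D y)"
  unfolding load_path_def
proof (intro conjI allI impI)
  fix j assume j: "j < S"
  have in0T: "tau_bar T D (y i) \<in> {0..T}" if "i \<le> S" for i
    using load_path_bounds[OF y that] tau_bar_in by auto
  have "staircase C T D y j \<le> D (tau_bar T D (y (Suc j)))"
  proof (cases "j = 0")
    case True
    then show ?thesis using in0T[of "Suc j"] j D_nonneg by auto
  next
    case False
    then have "staircase C T D y j \<le> D (tau_bar T D (y j))"
      using staircase_le_level by simp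
    also have "tau_bar T D (y j) \<le> tau_bar T D (y (Suc j))"
      using load_path_mono[OF y, of j "Suc j"] load_path_bounds[OF y, of "Suc j"] j
      by (intro tau_bar_mono) auto
    then have "D (tau_bar T D (y j)) \<le> D (tau_bar T D (y (Suc j)))"
      using in0T[of j] in0T[of "Suc j"] j by (intro D_le) auto
    finally show ?thesis .
  qed
  then show "staircase C T D y j \<le> staircase C T D y (Suc j)"
    using C_nonneg by simp
next
  have "staircase C T D y S \<le> D T"
  proof (cases S)
    case 0
    then show ?thesis by (simp add: DT_nonneg)
  next
    case (Suc i)
    then show ?thesis
      using staircase_le_level[of S] level_tau_bar_le_DT[of "y S"] load_path_bounds[OF y, of S]
      by force
  qed
  then show "staircase C T D y S = D T"
    using staircase_ge[of S] y by (simp add: load_path_def)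
qed simp_all

lemma staircase_tau_bar_le:
  assumes "0 < j" "j \<le> S"
  shows "tau_bar T D (staircase C T D y j) \<le> tau_bar T D (y j)"
  using staircase_le_level[OF assms(1)] load_path_bounds[OF y assms(2)]
    load_path_bounds[OF staircase_path assms(2)]
  by (intro tau_bar_least tau_bar_in) auto

text \<open>
  Each step of the staircase either reaches a demand level or adds a full load \<open>C\<close>. At most \<open>N\<close> full
  loads are ever relevant, as \<open>N * C\<close> already covers the total demand.
\<close>

lemma staircase_in_grid:
  assumes N: "D T \<le> real N * C" and j: "j \<le> S"
  shows "staircase C T D y j \<in> grid C T D N"
proof -
  let ?V = "insert 0 (insert (D 0) (D ` discontinuities T D))"
  have V_nonneg: "0 \<le> v" if "v \<in> ?V" for v
    using that D_nonneg T_nonneg by (auto simp: discontinuities_def)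
  have "\<exists>v\<in>?V. \<exists>k. staircase C T D y j = min (D T) (v + real k * C)"
    using j
  proof (induction j)
    case 0
    then show ?case using DT_nonneg by (intro bexI[of _ 0] exI[of _ 0]) auto
  next
    case (Suc j)
    let ?v = "D (tau_bar T D (y (Suc j)))"
    from Suc obtain v k where vk: "v \<in> ?V" "staircase C T D y j = min (D T) (v + real k * C)"
      by (meson Suc_leD)
    have y_le: "y (Suc j) \<le> D T"
      using load_path_bounds[OF y Suc.prems] by simp
    then have v: "?v \<in> ?V" "?v \<le> D T"
      using tau_bar_breakpoint level_tau_bar_le_DT by fastforce+
    show ?case
    proof (cases "?v \<le> staircase C T D y j + C")
      case True
      then show ?thesis using v by (intro bexI[of _ ?v] exI[of _ 0]) auto
    next
      case False
      then have "staircase C T D y (Suc j) = min (D T) (v + real (Suc k) * C)"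
        using vk(2) v(2) C_nonneg by (auto simp: min_def algebra_simps split: if_splits)
      then show ?thesis using vk(1) by blast
    qed
  qed
  then obtain v k where vk: "v \<in> ?V" "staircase C T D y j = min (D T) (v + real k * C)"
    by blast
  have "staircase C T D y j = min (D T) (v + real (min k N) * C)"
  proof (cases "k \<le> N")
    case False
    have "D T \<le> v + real N * C" "real N * C \<le> real k * C"
      using False N V_nonneg[OF vk(1)] C_nonneg by (auto intro!: mult_right_mono)
    then show ?thesis using vk False by auto
  qed (use vk in auto)
  then show ?thesis
    unfolding grid_def using vk(1) by fastforce
qed

end

lemma max_path_value:
  "path_value (max_step T D) y j =
     Max (insert 0 ((\<lambda>i. tau_bar T D (y (Suc i)) - tau T D (y i)) ` {..<j}))"
proof (induction j)
  case (Suc j)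
  let ?t = "\<lambda>i. tau_bar T D (y (Suc i)) - tau T D (y i)"
  have "insert 0 (?t ` {..<Suc j}) = insert (?t j) (insert 0 (?t ` {..<j}))"
    by (auto simp: lessThan_Suc)
  then have "Max (insert 0 (?t ` {..<Suc j})) = max (?t j) (Max (insert 0 (?t ` {..<j})))"
    by (simp only:) (rule Max_insert; simp)
  moreover have "path_value (max_step T D) y (Suc j) = max (path_value (max_step T D) y j) (?t j)"
    by (simp add: max_step_def)
  ultimately show ?case
    unfolding Suc by (metis max.commute)
qed simp

lemma ave_path_value:
  "path_value (ave_step T D) y j = (\<Sum>i<j. (y (Suc i) - y i) * tau_bar T D (y (Suc i)))"
  by (induction j) (auto simp: ave_step_def)

lemma some_shuttle_loaded:
  assumes "load_path S C (D T) y" "D T > 0"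
  obtains j where "j \<in> {1..S}" "y (j - 1) < y j"
proof -
  have "\<exists>j<S. y j < y (Suc j)"
  proof (rule ccontr)
    assume none: "\<not> ?thesis"
    have "i \<le> S \<Longrightarrow> y i \<le> 0" for i
    proof (induction i)
      case (Suc i)
      then have "y (Suc i) \<le> y i" using none by (meson Suc_le_lessD not_less)
      with Suc show ?case by simp
    qed (use assms(1) in \<open>simp add: load_path_def\<close>)
    then show False using assms by (force simp: load_path_def)
  qed
  then obtain j where "j < S" "y j < y (Suc j)" by auto
  then show thesis using that[of "Suc j"] by auto
qed

lemma g_max_tau_bar_le:
  assumes y: "load_path S C (D T) y" and pos: "D T > 0"
    and d: "\<And>j. j \<in> {1..S} \<Longrightarrow> d j = tau_bar T D (y j)"
  shows "g_max S T D d y \<le> path_value (max_step T D) y S"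
proof -
  obtain i where "i \<in> {1..S}" "y (i - 1) < y i"
    using some_shuttle_loaded[OF y pos] .
  then have ne: "{j \<in> {1..S}. y j > y (j - 1)} \<noteq> {}" by auto
  have "d j - tau T D (y (j - 1)) \<le> path_value (max_step T D) y S" if "j \<in> {1..S}" for j
  proof -
    have "d j - tau T D (y (j - 1)) \<in>
        (\<lambda>i. tau_bar T D (y (Suc i)) - tau T D (y i)) ` {..<S}"
      using that d[OF that] by (intro image_eqI[of _ _ "j - 1"]) auto
    then show ?thesis
      unfolding max_path_value by (intro Max_ge) auto
  qed
  with ne show ?thesis
    unfolding g_max_def by (subst Max_le_iff) auto
qed

text \<open>
  On the staircase no shuttle leaves later than before, and the first passenger of each shuttle arrives
  no earlier than before. A shuttle that was empty may be loaded by the staircase, but then it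
  takes passengers who arrive exactly at its departure time, and its cost is at most 0.
\<close>

lemma staircase_max_value_le:
  assumes feas: "feasible S C T 0 D d y" and S: "S > 0" and C: "C \<ge> 0" and pos: "D T > 0"
  shows "path_value (max_step T D) (staircase C T D y) S \<le> g_max S T D d y"
proof -
  note y = feasible_load_path[OF feas S]
  let ?z = "staircase C T D y"
  have d: "tau_bar T D (y j) \<le> d j" if "j \<in> {1..S}" for j
    using feas that by (auto simp: feasible_def)
  have g_ge: "d j - tau T D (y (j - 1)) \<le> g_max S T D d y" if "j \<in> {1..S}" "y (j - 1) < y j" for j
    unfolding g_max_def using that by (intro Max_ge) auto
  have g_nonneg: "0 \<le> g_max S T D d y"
  proof -
    obtain i where i: "i \<in> {1..S}" "y (i - 1) < y i"
      using some_shuttle_loaded[OF y pos] .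
    have "tau T D (y (i - 1)) \<le> tau_bar T D (y i)"
      using i load_path_bounds[OF y, of i] by (intro tau_le_tau_bar) auto
    then show ?thesis using g_ge[OF i] d[OF i(1)] by simp
  qed
  have "tau_bar T D (?z (Suc i)) - tau T D (?z i) \<le> g_max S T D d y" if i: "i < S" for i
  proof -
    have 1: "tau_bar T D (?z (Suc i)) \<le> tau_bar T D (y (Suc i))"
      using staircase_tau_bar_le[OF y C, of "Suc i"] i by (simp del: staircase.simps)
    have 2: "tau T D (y i) \<le> tau T D (?z i)"
      using staircase_ge[OF y C, of i] load_path_bounds[OF staircase_path[OF y C], of i] i
      by (intro tau_mono) auto
    show ?thesis
    proof (cases "y i < y (Suc i)")
      case True
      then show ?thesis using g_ge[of "Suc i"] d[of "Suc i"] i 1 2 by auto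
    next
      case False
      then have "y (Suc i) = y i" using y i by (force simp: load_path_def)
      then show ?thesis
        using 1 2 tau_bar_le_tau[of "y i"] load_path_bounds[OF y, of i] i g_nonneg by auto
    qed
  qed
  then show ?thesis
    unfolding max_path_value using g_nonneg by (subst Max_le_iff) auto
qed

text \<open>
  The waiting integrals telescope: the part involving \<open>tau_bar\<close> always adds up to its integral over
  the whole demand.
\<close>

lemma g_ave_eq:
  assumes y: "load_path S C (D T) y"
  shows "g_ave S T D d y =
    ((\<Sum>j<S. (y (Suc j) - y j) * d (Suc j)) - integral {0..D T} (tau_bar T D)) / D T"
proof -
  have int: "tau_bar T D integrable_on {a..b}" if "b \<le> D T" for a b
    using that by (intro integrable_on_mono_on) (auto simp: mono_on_def intro!: tau_bar_mono)
  have part: "integral {y j..y (Suc j)} (\<lambda>u. d (Suc j) - tau_bar T D u) =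
      (y (Suc j) - y j) * d (Suc j) - integral {y j..y (Suc j)} (tau_bar T D)" if "j < S" for j
    using load_path_bounds[OF y, of "Suc j"] load_path_mono[OF y, of j "Suc j"] that
    by (subst integral_diff) (auto intro!: int)
  have total: "(\<Sum>j<n. integral {y j..y (Suc j)} (tau_bar T D)) = integral {0..y n} (tau_bar T D)"
    if "n \<le> S" for n
    using that
  proof (induction n)
    case (Suc n)
    then have "integral {0..y n} (tau_bar T D) + integral {y n..y (Suc n)} (tau_bar T D) =
        integral {0..y (Suc n)} (tau_bar T D)"
      using load_path_bounds[OF y, of "Suc n"] load_path_bounds[OF y, of n]
        load_path_mono[OF y, of n "Suc n"]
      by (intro Henstock_Kurzweil_Integration.integral_combine int) auto
    with Suc show ?case by simp
  qed (use y in \<open>auto simp: load_path_def\<close>)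
  have "(\<Sum>j=1..S. integral {y (j - 1)..y j} (\<lambda>u. d j - tau_bar T D u)) =
      (\<Sum>j<S. integral {y j..y (Suc j)} (\<lambda>u. d (Suc j) - tau_bar T D u))"
    by (simp add: sum.shift_bounds_cl_Suc_ivl sum.atLeast1_atMost_eq)
  also have "\<dots> = (\<Sum>j<S. (y (Suc j) - y j) * d (Suc j)) - integral {0..D T} (tau_bar T D)"
    using total[of S] y by (simp add: part sum_subtractf load_path_def)
  finally show ?thesis
    unfolding g_ave_def by simp
qed

lemma staircase_ave_value_le:
  assumes feas: "feasible S C T 0 D d y" and S: "S > 0" and C: "C \<ge> 0"
  shows "path_value (ave_step T D) (staircase C T D y) S \<le> (\<Sum>j<S. (y (Suc j) - y j) * d (Suc j))"
proof -
  note y = feasible_load_path[OF feas S]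
  let ?z = "staircase C T D y" and ?e = "\<lambda>j. tau_bar T D (y (Suc j))"
  note z = staircase_path[OF y C]
  have e_mono: "?e j \<le> ?e (Suc j)" if "Suc j < S" for j
    using that load_path_mono[OF y, of "Suc j" "Suc (Suc j)"] load_path_bounds[OF y, of "Suc (Suc j)"]
    by (intro tau_bar_mono) auto
  have "path_value (ave_step T D) ?z S \<le> (\<Sum>j<S. (?z (Suc j) - ?z j) * ?e j)"
    unfolding ave_path_value
  proof (intro sum_mono mult_left_mono)
    fix j assume "j \<in> {..<S}"
    then show "tau_bar T D (?z (Suc j)) \<le> ?e j" "0 \<le> ?z (Suc j) - ?z j"
      using staircase_tau_bar_le[OF y C, of "Suc j"] load_path_mono[OF z, of j "Suc j"]
      by (auto simp del: staircase.simps)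
  qed
  also have "\<dots> \<le> (\<Sum>j<S. (y (Suc j) - y j) * ?e j) + (?z S - y S) * ?e (S - 1)"
    using S y staircase_ge[OF y C] e_mono
    by (intro increments_weighted_le) (auto simp: load_path_def simp del: staircase.simps(2))
  also have "?z S = y S"
    using y z by (simp add: load_path_def)
  also have "(\<Sum>j<S. (y (Suc j) - y j) * ?e j) \<le> (\<Sum>j<S. (y (Suc j) - y j) * d (Suc j))"
  proof (intro sum_mono mult_left_mono)
    fix j assume "j \<in> {..<S}"
    then show "?e j \<le> d (Suc j)" "0 \<le> y (Suc j) - y j"
      using feas load_path_mono[OF y, of j "Suc j"] by (auto simp: feasible_def)
  qed
  finally show ?thesis by simp
qed

end


section \<open>Bellman tables\<close>

text \<open>
  The pair \<open>(v, p)\<close> is a correct entry for node \<open>b\<close> if only the first \<open>m\<close> nodes of the preceding layer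
  are considered. In the array \<open>P\<close>, 0 marks an unreachable node and \<open>Suc a\<close> the predecessor \<open>a\<close>; this
  coding replaces an infinite cost.
\<close>

definition bellman_entry ::
  "(real \<Rightarrow> real \<Rightarrow> real \<Rightarrow> real) \<Rightarrow> real \<Rightarrow> (nat \<Rightarrow> real) \<Rightarrow> (nat \<Rightarrow> real) \<Rightarrow> (nat \<Rightarrow> nat) \<Rightarrow>
   nat \<Rightarrow> nat \<Rightarrow> real \<Rightarrow> nat \<Rightarrow> bool" where
  "bellman_entry f C g V P b m v p \<longleftrightarrow>
     (\<forall>a<m. 0 < P a \<and> g a \<le> g b \<and> g b \<le> g a + C \<longrightarrow> 0 < p \<and> v \<le> f (V a) (g a) (g b)) \<and>
     (0 < p \<longrightarrow> p - 1 < m \<and> 0 < P (p - 1) \<and> g (p - 1) \<le> g b \<and> g b \<le> g (p - 1) + C \<and>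
        v = f (V (p - 1)) (g (p - 1)) (g b))"

text \<open>
  Layer \<open>j\<close> of a table stored in one array. Beyond the width \<open>M\<close> a row is cut off to 0, so that writing
  into one row leaves the others equal as functions.
\<close>

definition row :: "nat \<Rightarrow> nat \<Rightarrow> (nat \<Rightarrow> 'a::zero) \<Rightarrow> nat \<Rightarrow> 'a" where
  "row M j A = (\<lambda>b. if b < M then A (j * M + b) else 0)"

lemma row_eq: "b < M \<Longrightarrow> row M j A b = A (j * M + b)"
  by (simp add: row_def)

lemma row_upd:
  assumes "b < M"
  shows "row M i (A(j * M + b := v)) = (if i = j then (row M j A)(b := v) else row M i A)"
proof -
  have "i * M + c = j * M + b \<longleftrightarrow> i = j \<and> c = b" if "c < M" for c
  proof
    assume eq: "i * M + c = j * M + b"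
    have "(i * M + c) div M = i" "(j * M + b) div M = j"
      using assms that by (auto simp: div_mult_self3)
    with eq show "i = j \<and> c = b" by simp
  qed simp
  then show ?thesis using assms by (auto simp: row_def fun_eq_iff)
qed

definition bellman_table ::
  "(real \<Rightarrow> real \<Rightarrow> real \<Rightarrow> real) \<Rightarrow> real \<Rightarrow> (nat \<Rightarrow> real) \<Rightarrow> nat \<Rightarrow> nat \<Rightarrow> (nat \<Rightarrow> real) \<Rightarrow>
   (nat \<Rightarrow> nat) \<Rightarrow> bool" where
  "bellman_table f C g M S V P \<longleftrightarrow>
     (\<forall>b<M. row M 0 P b = of_bool (b = 0)) \<and> row M 0 V 0 = 0 \<and>
     (\<forall>j<S. \<forall>b<M. bellman_entry f C g (row M j V) (row M j P) b M
        (row M (Suc j) V b) (row M (Suc j) P b))"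

primrec trace_back :: "(nat \<Rightarrow> nat) \<Rightarrow> nat \<Rightarrow> nat \<Rightarrow> nat \<Rightarrow> nat \<Rightarrow> nat" where
  "trace_back P M S e 0 = e"
| "trace_back P M S e (Suc i) = row M (S - i) P (trace_back P M S e i) - 1"

lemma bellman_entry_0: "bellman_entry f C g V P b 0 v 0"
  by (simp add: bellman_entry_def)

lemma bellman_entry_skip:
  assumes "bellman_entry f C g V P b m v p"
    and "0 < P m \<Longrightarrow> g m \<le> g b \<Longrightarrow> g b \<le> g m + C \<Longrightarrow> 0 < p \<and> v \<le> f (V m) (g m) (g b)"
  shows "bellman_entry f C g V P b (Suc m) v p"
  using assms unfolding bellman_entry_def by (auto simp: less_Suc_eq)

lemma bellman_entry_improve:
  assumes "bellman_entry f C g V P b m v p"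
    and "0 < P m" "g m \<le> g b" "g b \<le> g m + C"
    and "0 < p \<Longrightarrow> f (V m) (g m) (g b) \<le> v"
  shows "bellman_entry f C g V P b (Suc m) (f (V m) (g m) (g b)) (Suc m)"
  using assms unfolding bellman_entry_def by (fastforce simp: less_Suc_eq)

locale bellman =
  fixes f C g M S V P e
  assumes table: "bellman_table f C g M S V P"
    and f_mono: "v \<le> w \<Longrightarrow> f v a b \<le> f w a b"
    and g_0: "g 0 = 0" and M_pos: "0 < M" and S_pos: "0 < S" and e_less: "e < M"
begin

lemma entry:
  "j < S \<Longrightarrow> b < M \<Longrightarrow> bellman_entry f C g (row M j V) (row M j P) b M
     (row M (Suc j) V b) (row M (Suc j) P b)"
  using table by (simp add: bellman_table_def)

lemma table_relaxed:
  assumes "j < S" "a < M" "b < M" "0 < row M j P a" "g a \<le> g b" "g b \<le> g a + C"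
  shows "0 < row M (Suc j) P b" "row M (Suc j) V b \<le> f (row M j V a) (g a) (g b)"
  using entry[OF assms(1,3)] assms unfolding bellman_entry_def by auto

lemma table_tight:
  assumes "j < S" "b < M" "0 < row M (Suc j) P b"
  shows "row M (Suc j) P b - 1 < M" "0 < row M j P (row M (Suc j) P b - 1)"
    "g (row M (Suc j) P b - 1) \<le> g b" "g b \<le> g (row M (Suc j) P b - 1) + C"
    "row M (Suc j) V b = f (row M j V (row M (Suc j) P b - 1)) (g (row M (Suc j) P b - 1)) (g b)"
  using entry[OF assms(1,2)] assms unfolding bellman_entry_def by auto

text \<open>
  Bellman's principle: since \<open>f\<close> is monotone in the accumulated cost, replacing the initial part of a
  path by the best path to the same node does not increase the total cost.
\<close>

lemma table_le_path_value:
  assumes y: "load_path S C (g e) y" and on_grid: "\<And>j. j \<le> S \<Longrightarrow> y j \<in> g ` {..<M}"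
  shows "0 < row M S P e \<and> row M S V e \<le> path_value f y S"
proof -
  let ?bounded = "\<lambda>j b. 0 < row M j P b \<and> row M j V b \<le> path_value f y j"
  have step: "?bounded (Suc j) b"
    if "j < S" "b < M" "g b = y (Suc j)" and a: "a < M" "g a = y j" "?bounded j a" for j a b
  proof -
    have "g a \<le> g b" "g b \<le> g a + C"
      using y that by (auto simp: load_path_def)
    then have "0 < row M (Suc j) P b" "row M (Suc j) V b \<le> f (row M j V a) (y j) (y (Suc j))"
      using table_relaxed[of j a b] that by auto
    moreover have "f (row M j V a) (y j) (y (Suc j)) \<le> path_value f y (Suc j)"
      using a by (simp add: f_mono)
    ultimately show ?thesis by simp
  qed
  have ex: "j \<le> S \<Longrightarrow> \<exists>a<M. g a = y j \<and> ?bounded j a" for j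
  proof (induction j)
    case 0
    then show ?case
      using y table M_pos g_0 by (auto simp: load_path_def bellman_table_def intro!: exI[of _ 0])
  next
    case (Suc j)
    then obtain a where a: "a < M" "g a = y j" "?bounded j a" by auto
    obtain b where "b < M" "g b = y (Suc j)" using on_grid[OF Suc.prems] by auto
    then show ?case using step[of j b a] a Suc.prems by auto
  qed
  obtain a where "a < M" "g a = y (S - 1)" "?bounded (S - 1) a"
    using ex[of "S - 1"] by auto
  then show ?thesis
    using step[of "S - 1" e a] S_pos e_less y by (auto simp: load_path_def)
qed

context
  assumes reached: "0 < row M S P e"
begin

abbreviation node :: "nat \<Rightarrow> nat" where
  "node i \<equiv> trace_back P M S e i"

lemma node_reached: "i \<le> S \<Longrightarrow> node i < M \<and> 0 < row M (S - i) P (node i)"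
proof (induction i)
  case (Suc i)
  then have "S - i = Suc (S - Suc i)" "S - Suc i < S" by auto
  then show ?case using Suc table_tight(1,2)[of "S - Suc i" "node i"] by auto
qed (use e_less reached in auto)

lemma node_last: "node S = 0"
  using node_reached[of S] table by (auto simp: bellman_table_def split: if_splits)

lemma node_step:
  assumes "j < S"
  shows "g (node (S - j)) \<le> g (node (S - Suc j))" "g (node (S - Suc j)) \<le> g (node (S - j)) + C"
    "row M (Suc j) V (node (S - Suc j)) =
       f (row M j V (node (S - j))) (g (node (S - j))) (g (node (S - Suc j)))"
proof -
  have "S - j = Suc (S - Suc j)" and *: "S - (S - Suc j) = Suc j" using assms by auto
  then have node: "node (S - j) = row M (Suc j) P (node (S - Suc j)) - 1" by simp
  have "node (S - Suc j) < M \<and> 0 < row M (Suc j) P (node (S - Suc j))"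
    using node_reached[of "S - Suc j"] * by simp
  then show "g (node (S - j)) \<le> g (node (S - Suc j))" "g (node (S - Suc j)) \<le> g (node (S - j)) + C"
    "row M (Suc j) V (node (S - Suc j)) =
       f (row M j V (node (S - j))) (g (node (S - j))) (g (node (S - Suc j)))"
    unfolding node using table_tight(3-5)[OF assms] by blast+
qed

lemma trace_path: "load_path S C (g e) (\<lambda>j. g (node (S - j)))"
  unfolding load_path_def using node_last g_0 node_step(1,2) by auto

text \<open>
  The costs stored along the chain of predecessors are exactly the costs of the path that it
  describes, so the traced path attains the table value.
\<close>

lemma trace_value: "j \<le> S \<Longrightarrow> path_value f (\<lambda>j. g (node (S - j))) j = row M j V (node (S - j))"
proof (induction j)
  case 0
  then show ?case using node_last table by (simp add: bellman_table_def)
next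
  case (Suc j)
  then show ?case using node_step(3)[of j] by simp
qed

end

end


section \<open>Running times of structured programs\<close>

lemma nats_set_nat [simp]:
  "nats (set_nat x i v s) y = (if y = x then (nats s x)(i := v) else nats s y)"
  and reals_set_nat [simp]: "reals (set_nat x i v s) = reals s"
  and nats_set_real [simp]: "nats (set_real x i r s) = nats s"
  and reals_set_real [simp]:
    "reals (set_real x i r s) y = (if y = x then (reals s x)(i := r) else reals s y)"
  by (simp_all add: set_nat_def set_real_def)

lemma set_real_twice [simp]: "set_real x i r (set_real x i r' s) = set_real x i r s"
  by (simp add: set_real_def)

text \<open>
  Total correctness with a time bound \<open>n\<close>, in the style of a weakest precondition.
\<close>

definition finishes :: "demand_oracle \<Rightarrow> nat \<Rightarrow> com \<Rightarrow> store \<Rightarrow> (store \<Rightarrow> bool) \<Rightarrow> bool" where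
  "finishes q n c s Q \<longleftrightarrow> (\<exists>m t. exec q c s m t \<and> m \<le> n \<and> Q t)"

primrec loop_free :: "com \<Rightarrow> bool" where
  "loop_free Skip \<longleftrightarrow> True"
| "loop_free (NSet x e f) \<longleftrightarrow> True"
| "loop_free (RSet x e f) \<longleftrightarrow> True"
| "loop_free (Seq c1 c2) \<longleftrightarrow> loop_free c1 \<and> loop_free c2"
| "loop_free (Cond b c1 c2) \<longleftrightarrow> loop_free c1 \<and> loop_free c2"
| "loop_free (While b c) \<longleftrightarrow> False"

text \<open>
  Loop-free programs can be run symbolically; the equation for \<open>While\<close> is a dummy.
\<close>

primrec result :: "demand_oracle \<Rightarrow> com \<Rightarrow> store \<Rightarrow> store" where
  "result q Skip s = s"
| "result q (NSet x e f) s = set_nat x (nval s e) (nval s f) s"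
| "result q (RSet x e f) s = set_real x (nval s e) (rval q s f) s"
| "result q (Seq c1 c2) s = result q c2 (result q c1 s)"
| "result q (Cond b c1 c2) s = (if bval q s b then result q c1 s else result q c2 s)"
| "result q (While b c) s = s"

primrec max_cost :: "com \<Rightarrow> nat" where
  "max_cost Skip = 1"
| "max_cost (NSet x e f) = ncost e + ncost f + 1"
| "max_cost (RSet x e f) = ncost e + rcost f + 1"
| "max_cost (Seq c1 c2) = max_cost c1 + max_cost c2"
| "max_cost (Cond b c1 c2) = bcost b + max (max_cost c1) (max_cost c2) + 1"
| "max_cost (While b c) = 0"

lemma exec_loop_free:
  "loop_free c \<Longrightarrow> \<exists>n\<le>max_cost c. exec q c s n (result q c s)"
proof (induction c arbitrary: s)
  case (Seq c1 c2)
  then obtain n1 n2 where "n1 \<le> max_cost c1" "exec q c1 s n1 (result q c1 s)"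
    "n2 \<le> max_cost c2" "exec q c2 (result q c1 s) n2 (result q c2 (result q c1 s))"
    by (meson loop_free.simps(4))
  then show ?case by (auto intro!: exI[of _ "n1 + n2"] exec.Seq)
next
  case (Cond b c1 c2)
  then obtain n1 n2 where "n1 \<le> max_cost c1" "exec q c1 s n1 (result q c1 s)"
    "n2 \<le> max_cost c2" "exec q c2 s n2 (result q c2 s)"
    by (meson loop_free.simps(5))
  then show ?case
    by (cases "bval q s b")
       (auto intro: exI[of _ "bcost b + n1 + 1"] exI[of _ "bcost b + n2 + 1"]
          dest: exec.CondTrue exec.CondFalse)
next
  case (NSet x e f)
  then show ?case using exec.NSet[of q x e f s] by auto
next
  case (RSet x e f)
  then show ?case using exec.RSet[of q x e f s] by auto
qed (use exec.Skip in auto)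

lemma finishes_loop_free:
  "loop_free c \<Longrightarrow> Q (result q c s) \<Longrightarrow> max_cost c \<le> n \<Longrightarrow> finishes q n c s Q"
  using exec_loop_free[of c q s] unfolding finishes_def by (meson order_trans)

lemma finishes_Seq:
  "finishes q n1 c1 s (\<lambda>t. finishes q n2 c2 t Q) \<Longrightarrow> finishes q (n1 + n2) (Seq c1 c2) s Q"
  unfolding finishes_def by (meson add_mono exec.Seq)

lemma finishes_Seq_loop_free:
  "loop_free c1 \<Longrightarrow> finishes q n2 c2 (result q c1 s) Q \<Longrightarrow> max_cost c1 \<le> n1 \<Longrightarrow>
     finishes q (n1 + n2) (Seq c1 c2) s Q"
  by (rule finishes_Seq, rule finishes_loop_free)

lemma finishes_weaken:
  "finishes q n c s Q \<Longrightarrow> (\<And>t. Q t \<Longrightarrow> R t) \<Longrightarrow> n \<le> m \<Longrightarrow> finishes q m c s R"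
  unfolding finishes_def by (meson order_trans)

lemma finishes_While:
  assumes "I 0 s" and "\<And>k s. I k s \<Longrightarrow> bval q s b \<longleftrightarrow> k < n"
    and "\<And>k s. k < n \<Longrightarrow> I k s \<Longrightarrow> finishes q B c s (I (Suc k))"
  shows "finishes q (n * (B + bcost b + 1) + bcost b + 1) (While b c) s (I n)"
proof -
  have "finishes q ((n - k) * (B + bcost b + 1) + bcost b + 1) (While b c) s (I n)"
    if "k \<le> n" "I k s" for k s
    using that
  proof (induction "n - k" arbitrary: k s)
    case 0
    then have "k = n" by simp
    then show ?case
      using 0 assms(2)[of k s] exec.WhileFalse[of q s b c] unfolding finishes_def by force
  next
    case (Suc d)
    then have k: "k < n" "n - k = Suc (n - Suc k)" by auto
    obtain m t where t: "exec q c s m t" "m \<le> B" "I (Suc k) t"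
      using assms(3)[OF k(1) Suc.prems(2)] unfolding finishes_def by auto
    obtain m' t' where t': "exec q (While b c) t m' t'"
      "m' \<le> (n - Suc k) * (B + bcost b + 1) + bcost b + 1" "I n t'"
      using Suc.hyps(1)[of "Suc k" t] Suc.hyps(2) k t(3) unfolding finishes_def by auto
    have "exec q (While b c) s (bcost b + m + m' + 1) t'"
      using assms(2)[OF Suc.prems(2)] k(1) by (intro exec.WhileTrue[OF _ t(1) t'(1)]) simp
    moreover have "bcost b + m + m' + 1 \<le> (n - k) * (B + bcost b + 1) + bcost b + 1"
      unfolding k(2) using t(2) t'(2) by simp
    ultimately show ?case using t'(3) unfolding finishes_def by blast
  qed
  from this[of 0 s] assms(1) show ?thesis by simp
qed

abbreviation NVar :: "vname \<Rightarrow> nexp" where "NVar x \<equiv> NGet x (NLit 0)"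
abbreviation RVar :: "vname \<Rightarrow> rexp" where "RVar x \<equiv> RGet x (NLit 0)"
abbreviation NAssign :: "vname \<Rightarrow> nexp \<Rightarrow> com" where "NAssign x e \<equiv> NSet x (NLit 0) e"
abbreviation RAssign :: "vname \<Rightarrow> rexp \<Rightarrow> com" where "RAssign x e \<equiv> RSet x (NLit 0) e"

definition For :: "vname \<Rightarrow> nexp \<Rightarrow> com \<Rightarrow> com" where
  "For x e c = Seq (NAssign x (NLit 0))
     (While (NLess (NVar x) e) (Seq c (NAssign x (NAdd (NVar x) (NLit 1)))))"

text \<open>
  The loop counter is not part of the invariant \<open>I\<close>, which is therefore required to be insensitive to
  it. The additive constants account for initialising, testing and incrementing the counter.
\<close>

lemma finishes_For:
  assumes init: "I 0 s"
    and bound: "\<And>k s. I k s \<Longrightarrow> nval s e = n"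
    and frame: "\<And>k v s. I k s \<Longrightarrow> I k (set_nat x 0 v s)"
    and step: "\<And>k s. k < n \<Longrightarrow> I k s \<Longrightarrow> nats s x 0 = k \<Longrightarrow>
      finishes q B c s (\<lambda>t. I (Suc k) t \<and> nats t x 0 = k)"
  shows "finishes q (n * (B + ncost e + 10) + ncost e + 7) (For x e c) s (I n)"
proof -
  let ?J = "\<lambda>k s. I k s \<and> nats s x 0 = k"
  let ?b = "NLess (NVar x) e" and ?c = "Seq c (NAssign x (NAdd (NVar x) (NLit 1)))"
  have body: "finishes q (B + 6) ?c s (?J (Suc k))" if "k < n" "?J k s" for k s
    using that step[of k s] frame
    by (auto intro!: finishes_Seq finishes_loop_free elim!: finishes_weaken)
  have "finishes q (n * ((B + 6) + bcost ?b + 1) + bcost ?b + 1) (While ?b ?c) (set_nat x 0 0 s) (?J n)"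
  proof (rule finishes_While[where I = ?J and n = n])
    show "bval q t ?b \<longleftrightarrow> k < n" if "?J k t" for k t
      using that bound[of k t] by auto
  qed (use init frame body in auto)
  then have "finishes q (3 + (n * ((B + 6) + bcost ?b + 1) + bcost ?b + 1)) (For x e c) s (?J n)"
    unfolding For_def by (intro finishes_Seq_loop_free) auto
  then show ?thesis
    by (rule finishes_weaken) (auto simp: algebra_simps)
qed


section \<open>Generating the grid\<close>

text \<open>
  The language has no rounding of reals to naturals, so the number \<open>N\<close> of full loads that cover the
  demand is found by counting. The loop takes about \<open>D T / C\<close> steps, a constant of the model.
\<close>

definition count_loads :: com where
  "count_loads = While (RLess (RVar ''x'') (RVar ''DT''))
     (Seq (NAssign ''N'' (NAdd (NVar ''N'') (NLit 1)))
          (RAssign ''x'' (RAdd (RVar ''x'') (RVar ''C''))))"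

definition ray_step :: com where
  "ray_step =
     Seq (RSet ''g'' (NVar ''M'') (RVar ''x''))
    (Seq (NAssign ''M'' (NAdd (NVar ''M'') (NLit 1)))
    (Seq (RAssign ''x'' (RAdd (RVar ''x'') (RVar ''C'')))
         (Cond (RLess (RVar ''DT'') (RVar ''x'')) (RAssign ''x'' (RVar ''DT'')) Skip)))"

text \<open>
  Appends to the grid the points reached from the level \<open>e\<close> by up to \<open>N\<close> full loads.
\<close>

definition ray :: "rexp \<Rightarrow> com" where
  "ray e = Seq (RAssign ''x'' e) (For ''k'' (NAdd (NVar ''N'') (NLit 1)) ray_step)"

text \<open>
  Starting with \<open>M = 1\<close> makes \<open>g 0 = 0\<close> the source, as arrays are initially 0; the final write makes
  the last point \<open>D T\<close>, the target. Repeated points are harmless.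
\<close>

definition make_grid :: com where
  "make_grid =
     Seq (NAssign ''M'' (NLit 1))
    (Seq count_loads
    (Seq (ray (RLit 0))
    (Seq (ray (QEval (RLit 0)))
    (Seq (For ''i'' (NVar ''K'') (ray (QEval (RGet ''disc'' (NVar ''i'')))))
    (Seq (RSet ''g'' (NVar ''M'') (RVar ''DT''))
         (NAssign ''M'' (NAdd (NVar ''M'') (NLit 1))))))))"

lemma image_append: "f ` {..<m} = A \<Longrightarrow> (f(m := v)) ` {..<Suc m} = insert v A"
  by (auto simp: lessThan_Suc image_def)

locale shuttle_instance = step_demand +
  fixes S :: nat and C :: real
  assumes S_pos: "0 < S" and C_pos: "0 < C" and DT_pos: "0 < D T"
begin

abbreviation "oracle \<equiv> oracle_of T 0 D"
abbreviation "breaks \<equiv> sorted_list_of_set (discontinuities T D)"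
abbreviation "K \<equiv> card (discontinuities T D)"
definition "N = nat \<lceil>D T / C\<rceil>"
text \<open>
  The number of grid points: \<open>K + 2\<close> rays together with the source and the target.
\<close>

definition "M = (K + 2) * Suc N + 2"

lemma less_N_iff: "k < N \<longleftrightarrow> real k * C < D T"
proof -
  have "k < N \<longleftrightarrow> real k < D T / C"
    unfolding N_def by (simp add: zless_nat_eq_int_zless less_ceiling_iff)
  then show ?thesis using C_pos by (simp add: field_simps)
qed

lemma N_loads_suffice: "D T \<le> real N * C"
  using less_N_iff[of N] by simp

text \<open>
  What grid generation needs from the input, and what it has to leave intact for the later phases.
\<close>

definition unprocessed :: "store \<Rightarrow> bool" where
  "unprocessed s \<longleftrightarrow> nats s ''S'' 0 = S \<and> nats s ''K'' 0 = K \<and> reals s ''C'' 0 = C \<and>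
     reals s ''DT'' 0 = D T \<and> (\<forall>i<K. reals s ''disc'' i = breaks ! i) \<and>
     nats s ''P'' = (\<lambda>_. 0) \<and> reals s ''V'' = (\<lambda>_. 0) \<and> reals s ''y'' 0 = 0"

definition gridded :: "real set \<Rightarrow> nat \<Rightarrow> store \<Rightarrow> bool" where
  "gridded A m s \<longleftrightarrow> unprocessed s \<and> nats s ''N'' 0 = N \<and> nats s ''M'' 0 = m \<and> 0 < m \<and>
     reals s ''g'' 0 = 0 \<and> reals s ''g'' ` {..<m} = A"

definition ray_points :: "nat \<Rightarrow> real \<Rightarrow> real set" where
  "ray_points n v = (\<lambda>k. min (D T) (v + real k * C)) ` {..<n}"

lemma breaks_less: "i < K \<Longrightarrow> breaks ! i \<in> discontinuities T D"
  using finite_discontinuities by (metis nth_mem set_sorted_list_of_set sorted_list_of_set.length_sorted_key_list_of_set)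

lemma ray_points_Suc: "ray_points (Suc n) v = insert (min (D T) (v + real n * C)) (ray_points n v)"
  by (auto simp: ray_points_def lessThan_Suc)

lemma count_loads_finishes:
  assumes "unprocessed s" "nats s ''N'' 0 = 0" "reals s ''x'' 0 = 0" "nats s ''M'' 0 = 1"
    "reals s ''g'' 0 = 0"
  shows "finishes oracle (20 * Suc N) count_loads s (gridded {0} 1)"
proof -
  let ?I = "\<lambda>k s. unprocessed s \<and> nats s ''N'' 0 = k \<and> reals s ''x'' 0 = real k * C \<and>
    nats s ''M'' 0 = 1 \<and> reals s ''g'' 0 = 0"
  have "finishes oracle (N * (13 + 5 + 1) + 5 + 1) count_loads s (?I N)"
    unfolding count_loads_def
    by (rule finishes_weaken, rule finishes_While[where I = ?I and B = 13 and n = N])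
       (use assms less_N_iff in \<open>auto intro!: finishes_loop_free simp: unprocessed_def algebra_simps\<close>)
  then show ?thesis
    by (rule finishes_weaken) (auto simp: gridded_def)
qed

lemma ray_finishes:
  assumes s: "gridded A m s" and v: "rval oracle s e = v" "v \<le> D T"
  shows "finishes oracle ((60 + rcost e) * Suc N) (ray e) s
    (\<lambda>t. gridded (A \<union> ray_points (Suc N) v) (m + Suc N) t \<and> nats t ''i'' = nats s ''i'')"
proof -
  let ?I = "\<lambda>k t. gridded (A \<union> ray_points k v) (m + k) t \<and>
    reals t ''x'' 0 = min (D T) (v + real k * C) \<and> nats t ''i'' = nats s ''i''"
  let ?s = "set_real ''x'' 0 v s"
  have "finishes oracle (Suc N * (28 + ncost (NAdd (NVar ''N'') (NLit 1)) + 10) +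
      ncost (NAdd (NVar ''N'') (NLit 1)) + 7)
    (For ''k'' (NAdd (NVar ''N'') (NLit 1)) ray_step) ?s (?I (Suc N))"
  proof (rule finishes_For)
    show "?I 0 ?s"
      using s v by (auto simp: gridded_def unprocessed_def ray_points_def)
  next
    fix k t assume k: "k < Suc N" "?I k t" "nats t ''k'' 0 = k"
    have clamp: "min (D T) (min (D T) (v + real k * C) + C) = min (D T) (v + real (Suc k) * C)"
      using C_pos by (auto simp: min_def algebra_simps)
    let ?x = "min (D T) (v + real k * C)"
    have res: "result oracle ray_step t =
        set_real ''x'' 0 (min (D T) (v + real (Suc k) * C))
          (set_nat ''M'' 0 (Suc (m + k)) (set_real ''g'' (m + k) ?x t))"
      using k unfolding clamp[symmetric]
      by (auto simp: ray_step_def gridded_def unprocessed_def min_def not_less)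
    have "?I (Suc k) (result oracle ray_step t)"
      using k image_append[of "reals t ''g''" "m + k" _ ?x] unfolding res
      by (auto simp: gridded_def unprocessed_def ray_points_Suc)
    moreover have "nats (result oracle ray_step t) ''k'' 0 = k"
      using k by (simp add: res)
    ultimately show "finishes oracle 28 ray_step t (\<lambda>t. ?I (Suc k) t \<and> nats t ''k'' 0 = k)"
      by (intro finishes_loop_free) (auto simp: ray_step_def)
  qed (auto simp: gridded_def unprocessed_def)
  then have "finishes oracle (rcost e + 2 + (Suc N * 42 + 11)) (ray e) s (?I (Suc N))"
    unfolding ray_def using v
    by (intro finishes_Seq_loop_free) (auto elim!: finishes_weaken)
  then show ?thesis
    by (rule finishes_weaken) (auto simp: algebra_simps)
qed

definition ready :: "(nat \<Rightarrow> real) \<Rightarrow> store \<Rightarrow> bool" where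
  "ready g s \<longleftrightarrow> nats s ''S'' 0 = S \<and> reals s ''C'' 0 = C \<and> nats s ''M'' 0 = M \<and>
     reals s ''g'' = g \<and> reals s ''y'' 0 = 0"

definition covers_grid :: "(nat \<Rightarrow> real) \<Rightarrow> bool" where
  "covers_grid g \<longleftrightarrow> g 0 = 0 \<and> g (M - 1) = D T \<and>
     grid C T D N \<subseteq> g ` {..<M} \<and> g ` {..<M} \<subseteq> {0..D T}"

lemma ray_points_bounds: "0 \<le> v \<Longrightarrow> ray_points n v \<subseteq> {0..D T}"
  using C_pos DT_pos by (auto simp: ray_points_def)

lemma grid_eq_rays:
  "grid C T D N = ray_points (Suc N) 0 \<union> ray_points (Suc N) (D 0) \<union>
     (\<Union>i<K. ray_points (Suc N) (D (breaks ! i)))"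
proof -
  have "set breaks = (!) breaks ` {..<length breaks}"
    by (auto simp: set_conv_nth)
  then have breaks: "discontinuities T D = (!) breaks ` {..<K}"
    using finite_discontinuities by simp
  have "grid C T D N =
      (\<Union>v\<in>insert 0 (insert (D 0) (D ` discontinuities T D)). ray_points (Suc N) v)"
    unfolding grid_def ray_points_def lessThan_Suc_atMost by blast
  then show ?thesis
    using arg_cong[OF breaks, of "\<lambda>A. \<Union>t\<in>A. ray_points (Suc N) (D t)"]
    by (simp add: Un_assoc image_image)
qed

lemma make_grid_finishes:
  assumes s: "unprocessed s" "nats s ''N'' 0 = 0" "reals s ''x'' 0 = 0" "reals s ''g'' 0 = 0"
  shows "finishes oracle (200 * M) make_grid s
    (\<lambda>t. \<exists>g. covers_grid g \<and> ready g t \<and> nats t ''P'' = (\<lambda>_. 0) \<and> reals t ''V'' = (\<lambda>_. 0))"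
proof -
  let ?R = "ray_points (Suc N)"
  let ?A1 = "{0} \<union> ?R 0" and ?A2 = "{0} \<union> ?R 0 \<union> ?R (D 0)" and ?m2 = "1 + Suc N + Suc N"
  let ?A = "\<lambda>i. ?A2 \<union> (\<Union>l<i. ?R (D (breaks ! l)))" and ?m = "\<lambda>i. ?m2 + i * Suc N"
  have rays: "finishes oracle (K * (64 * Suc N + 2 + 10) + 2 + 7)
      (For ''i'' (NVar ''K'') (ray (QEval (RGet ''disc'' (NVar ''i''))))) t (gridded (?A K) (?m K))"
    if "gridded ?A2 ?m2 t" for t
  proof -
    let ?e = "QEval (RGet ''disc'' (NVar ''i''))"
    have "finishes oracle (K * (64 * Suc N + ncost (NVar ''K'') + 10) + ncost (NVar ''K'') + 7)
        (For ''i'' (NVar ''K'') (ray ?e)) t (gridded (?A K) (?m K))"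
    proof (rule finishes_For[where I = "\<lambda>i. gridded (?A i) (?m i)"])
      fix i u assume i: "i < K" and u: "gridded (?A i) (?m i) u" "nats u ''i'' 0 = i"
      have b: "breaks ! i \<in> {0..T}"
        using breaks_less[OF i] by (auto simp: discontinuities_def)
      have "rval oracle u ?e = D (breaks ! i)"
        using u i b by (simp add: gridded_def unprocessed_def oracle_of_def)
      note ray = ray_finishes[OF u(1) this D_le_DT[OF b]]
      have A: "?A i \<union> ?R (D (breaks ! i)) = ?A (Suc i)"
        by (auto simp: lessThan_Suc)
      have m: "?m i + Suc N = ?m (Suc i)"
        by simp
      show "finishes oracle (64 * Suc N) (ray ?e) u
          (\<lambda>t. gridded (?A (Suc i)) (?m (Suc i)) t \<and> nats t ''i'' 0 = i)"
        by (rule finishes_weaken[OF ray, unfolded A m]) (use u in simp_all)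
    qed (use that in \<open>auto simp: gridded_def unprocessed_def\<close>)
    then show ?thesis by simp
  qed
  have last: "\<exists>g. covers_grid g \<and> ready g t' \<and> nats t' ''P'' = (\<lambda>_. 0) \<and> reals t' ''V'' = (\<lambda>_. 0)"
    if t: "gridded (?A K) (?m K) t"
      and t': "t' = set_nat ''M'' 0 (Suc (nats t ''M'' 0)) (set_real ''g'' (nats t ''M'' 0) (D T) t)"
    for t t'
  proof (intro exI[of _ "reals t' ''g''"] conjI)
    have M: "M = Suc (?m K)" by (simp add: M_def)
    have g: "reals t' ''g'' ` {..<M} = insert (D T) (insert 0 (grid C T D N))"
      unfolding M grid_eq_rays using t image_append[of "reals t ''g''" "?m K" "?A K" "D T"]
      by (auto simp: t' gridded_def)
    have "0 \<le> D 0" "\<And>i. i < K \<Longrightarrow> 0 \<le> D (breaks ! i)"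
      using D_nonneg T_nonneg breaks_less by (auto simp: discontinuities_def)
    then have "grid C T D N \<subseteq> {0..D T}"
      unfolding grid_eq_rays by (intro Un_least UN_least ray_points_bounds) auto
    then show "covers_grid (reals t' ''g'')"
      using DT_pos t unfolding covers_grid_def g by (auto simp: t' gridded_def M)
  qed (use t in \<open>auto simp: t' ready_def gridded_def unprocessed_def M_def\<close>)
  have e0: "rval oracle t (RLit 0) = 0" "rval oracle t (QEval (RLit 0)) = D 0" for t
    using T_nonneg by (auto simp: oracle_of_def)
  let ?Q = "\<lambda>t. \<exists>g. covers_grid g \<and> ready g t \<and> nats t ''P'' = (\<lambda>_. 0) \<and> reals t ''V'' = (\<lambda>_. 0)"
  let ?c5 = "Seq (RSet ''g'' (NVar ''M'') (RVar ''DT'')) (NAssign ''M'' (NAdd (NVar ''M'') (NLit 1)))"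
  let ?c4 = "Seq (For ''i'' (NVar ''K'') (ray (QEval (RGet ''disc'' (NVar ''i''))))) ?c5"
  let ?c3 = "Seq (ray (QEval (RLit 0))) ?c4"
  let ?c2 = "Seq (ray (RLit 0)) ?c3"
  let ?n4 = "(K * (64 * Suc N + 2 + 10) + 2 + 7) + 20"
  have 5: "finishes oracle 20 ?c5 t ?Q" if "gridded (?A K) (?m K) t" for t
    by (rule finishes_loop_free) (use last[OF that] that in \<open>auto simp: gridded_def unprocessed_def\<close>)
  have 4: "finishes oracle ?n4 ?c4 t ?Q" if "gridded ?A2 ?m2 t" for t
    by (rule finishes_Seq, rule finishes_weaken[OF rays[OF that]], rule 5) auto
  have 3: "finishes oracle (62 * Suc N + ?n4) ?c3 t ?Q" if "gridded ?A1 (1 + Suc N) t" for t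
  proof (rule finishes_Seq, rule finishes_weaken[OF ray_finishes[OF that e0(2)]])
    show "D 0 \<le> D T" using D_le_DT T_nonneg by simp
  qed (rule 4, simp_all)
  have 2: "finishes oracle (61 * Suc N + (62 * Suc N + ?n4)) ?c2 t ?Q" if "gridded {0} 1 t" for t
    by (rule finishes_Seq, rule finishes_weaken[OF ray_finishes[OF that e0(1)]], rule DT_nonneg, rule 3) simp_all
  have 1: "finishes oracle (20 * Suc N) count_loads (result oracle (NAssign ''M'' (NLit 1)) s) (gridded {0} 1)"
    by (rule count_loads_finishes) (use s in \<open>auto simp: unprocessed_def\<close>)
  have "finishes oracle (3 + (20 * Suc N + (61 * Suc N + (62 * Suc N + ?n4)))) make_grid s ?Q"
    unfolding make_grid_def
    by (rule finishes_Seq_loop_free, simp, rule finishes_Seq, rule finishes_weaken[OF 1], rule 2) simp_all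
  then show ?thesis
    by (rule finishes_weaken) (auto simp: M_def algebra_simps)
qed

end


section \<open>Filling the Bellman table and reading off a path\<close>

abbreviation at_grid :: "vname \<Rightarrow> rexp" where "at_grid x \<equiv> RGet ''g'' (NVar x)"
abbreviation entry_ja :: nexp where
  "entry_ja \<equiv> NAdd (NMul (NVar ''j'') (NVar ''M'')) (NVar ''a'')"
abbreviation next_entry_jb :: nexp where
  "next_entry_jb \<equiv> NAdd (NMul (NAdd (NVar ''j'') (NLit 1)) (NVar ''M'')) (NVar ''b'')"

definition usable :: bexp where
  "usable = Conj (NLess (NLit 0) (NGet ''P'' entry_ja))
     (Conj (Neg (RLess (at_grid ''b'') (at_grid ''a'')))
           (Neg (RLess (RAdd (at_grid ''a'') (RVar ''C'')) (at_grid ''b''))))"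

text \<open>
  Costs may have any sign, so a stored value may only be compared after the predecessor code has shown
  it to be valid.
\<close>

definition record_cand :: com where
  "record_cand =
     Cond (Conj (NLess (NLit 0) (NGet ''P'' next_entry_jb))
                (Neg (RLess (RVar ''cand'') (RGet ''V'' next_entry_jb))))
       Skip
       (Seq (RSet ''V'' next_entry_jb (RVar ''cand''))
            (NSet ''P'' next_entry_jb (NAdd (NVar ''a'') (NLit 1))))"

definition relax :: "com \<Rightarrow> com" where
  "relax W = Cond usable (Seq W record_cand) Skip"

definition fill_entry :: "com \<Rightarrow> com" where
  "fill_entry W = Seq (NSet ''P'' next_entry_jb (NLit 0)) (For ''a'' (NVar ''M'') (relax W))"

definition fill_table :: "com \<Rightarrow> com" where
  "fill_table W = Seq (NSet ''P'' (NLit 0) (NLit 1))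
     (For ''j'' (NVar ''S'') (For ''b'' (NVar ''M'') (fill_entry W)))"

definition trace_step :: com where
  "trace_step =
     (let l = NSub (NVar ''S'') (NVar ''i'') in
      Seq (RSet ''y'' l (at_grid ''e''))
     (Seq (RSet ''d'' l (QTauBar (at_grid ''e'')))
          (NAssign ''e'' (NSub (NGet ''P'' (NAdd (NMul l (NVar ''M'')) (NVar ''e''))) (NLit 1)))))"

text \<open>
  Walks back from the target \<open>D T\<close>; in round \<open>i\<close> it writes the entries with index \<open>S - i\<close>.
\<close>

definition read_off :: com where
  "read_off = Seq (NAssign ''e'' (NSub (NVar ''M'') (NLit 1))) (For ''i'' (NVar ''S'') trace_step)"

definition solver :: "com \<Rightarrow> com" where
  "solver W = Seq make_grid (Seq (fill_table W) read_off)"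

text \<open>
  The code fragment \<open>W\<close> computes the cost of extending the best path to node \<open>a\<close> of layer \<open>j\<close> by the
  step to node \<open>b\<close>, and changes nothing but the cell \<open>''cand''\<close>. The two problems differ only in \<open>f\<close>
  and \<open>W\<close>.
\<close>

locale shuttle_program = shuttle_instance +
  fixes f :: "real \<Rightarrow> real \<Rightarrow> real \<Rightarrow> real" and W :: com
  assumes f_mono: "v \<le> w \<Longrightarrow> f v a b \<le> f w a b"
    and W_loop_free: "loop_free W"
    and W_result: "\<And>s ga gb.
      ga = reals s ''g'' (nats s ''a'' 0) \<Longrightarrow> gb = reals s ''g'' (nats s ''b'' 0) \<Longrightarrow>
      0 \<le> ga \<Longrightarrow> ga \<le> gb \<Longrightarrow> gb \<le> D T \<Longrightarrow>
      result (oracle_of T 0 D) W s =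
        set_real ''cand'' 0
          (f (reals s ''V'' (nats s ''j'' 0 * nats s ''M'' 0 + nats s ''a'' 0)) ga gb) s"
begin

context
  fixes g :: "nat \<Rightarrow> real"
  assumes g: "covers_grid g"
begin

lemma g_bounds: "a < M \<Longrightarrow> 0 \<le> g a \<and> g a \<le> D T"
  using g by (force simp: covers_grid_def)

definition filled :: "nat \<Rightarrow> store \<Rightarrow> bool" where
  "filled j s \<longleftrightarrow> ready g s \<and> bellman_table f C g M j (reals s ''V'') (nats s ''P'')"

definition entry_filled :: "nat \<Rightarrow> nat \<Rightarrow> nat \<Rightarrow> store \<Rightarrow> bool" where
  "entry_filled j b m s \<longleftrightarrow>
     bellman_entry f C g (row M j (reals s ''V'')) (row M j (nats s ''P'')) b m
       (row M (Suc j) (reals s ''V'') b) (row M (Suc j) (nats s ''P'') b)"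

definition row_filled :: "nat \<Rightarrow> nat \<Rightarrow> store \<Rightarrow> bool" where
  "row_filled j b s \<longleftrightarrow> filled j s \<and> nats s ''j'' 0 = j \<and> (\<forall>b'<b. entry_filled j b' M s)"

text \<open>
  All cells of the table that are written lie in row \<open>Suc j\<close>, so the completed rows remain valid, and
  row \<open>j\<close> keeps the values that the entry refers to.
\<close>

lemma relax_finishes:
  assumes s: "row_filled j b s" "nats s ''b'' 0 = b" "entry_filled j b a s" "nats s ''a'' 0 = a"
    and ab: "a < M" "b < M"
  shows "finishes oracle (max_cost (relax W)) (relax W) s
    (\<lambda>t. row_filled j b t \<and> nats t ''b'' 0 = b \<and> entry_filled j b (Suc a) t \<and> nats t ''a'' 0 = a)"
proof (rule finishes_loop_free)
  let ?V = "reals s ''V''" and ?P = "nats s ''P''" and ?i = "Suc j * M + b"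
  let ?c = "f (row M j ?V a) (g a) (g b)"
  let ?improve = "set_nat ''P'' ?i (Suc a) (set_real ''V'' ?i ?c (set_real ''cand'' 0 ?c s))"
  have ctx: "nats s ''j'' 0 = j" "nats s ''M'' 0 = M" "reals s ''g'' = g" "reals s ''C'' 0 = C"
    using s by (auto simp: row_filled_def filled_def ready_def)
  have usable: "bval oracle s usable \<longleftrightarrow> 0 < row M j ?P a \<and> g a \<le> g b \<and> g b \<le> g a + C"
    using s ab ctx by (auto simp: usable_def row_eq)
  have W: "result oracle W s = set_real ''cand'' 0 ?c s" if "g a \<le> g b"
    using W_result[of "g a" s "g b"] ctx s that ab g_bounds by (simp add: row_eq)
  have recorded: "result oracle record_cand (set_real ''cand'' 0 ?c s) =
      (if 0 < row M (Suc j) ?P b \<and> row M (Suc j) ?V b \<le> ?c then set_real ''cand'' 0 ?c s else ?improve)"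
    using s ab ctx by (auto simp: record_cand_def row_eq)
  have res: "result oracle (relax W) s =
      (if 0 < row M j ?P a \<and> g a \<le> g b \<and> g b \<le> g a + C
       then if 0 < row M (Suc j) ?P b \<and> row M (Suc j) ?V b \<le> ?c then set_real ''cand'' 0 ?c s else ?improve
       else s)"
    using W recorded by (simp add: relax_def usable)
  have keep: "row_filled j b t \<and> nats t ''b'' 0 = b \<and> nats t ''a'' 0 = a"
    if "t = s \<or> t = set_real ''cand'' 0 ?c s \<or> t = ?improve" for t
    using that s ab
    by (auto simp: row_filled_def filled_def ready_def bellman_table_def entry_filled_def
        row_upd simp del: mult_Suc)
  show "row_filled j b (result oracle (relax W) s) \<and> nats (result oracle (relax W) s) ''b'' 0 = b \<and>
      entry_filled j b (Suc a) (result oracle (relax W) s) \<and> nats (result oracle (relax W) s) ''a'' 0 = a"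
  proof (cases "0 < row M j ?P a \<and> g a \<le> g b \<and> g b \<le> g a + C")
    case False
    then have "result oracle (relax W) s = s" by (simp only: res if_False)
    moreover have "entry_filled j b (Suc a) s"
      using s(3) False unfolding entry_filled_def by (intro bellman_entry_skip) auto
    ultimately show ?thesis using keep[of s] by simp
  next
    case edge: True
    show ?thesis
    proof (cases "0 < row M (Suc j) ?P b \<and> row M (Suc j) ?V b \<le> ?c")
      case True
      then have "result oracle (relax W) s = set_real ''cand'' 0 ?c s" using edge by (simp add: res)
      moreover have "entry_filled j b (Suc a) (set_real ''cand'' 0 ?c s)"
        using s(3) True unfolding entry_filled_def by (auto intro: bellman_entry_skip)
      ultimately show ?thesis using keep[of "set_real ''cand'' 0 ?c s"] by simp
    next
      case False
      then have "result oracle (relax W) s = ?improve" using edge by (simp only: res if_True if_False simp_thms)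
      moreover have "entry_filled j b (Suc a) ?improve"
        using s(3) False edge ab unfolding entry_filled_def
        by (auto simp: row_upd simp del: mult_Suc intro!: bellman_entry_improve)
      ultimately show ?thesis using keep[of ?improve] by simp
    qed
  qed
qed (simp_all add: relax_def record_cand_def W_loop_free)

lemma fill_entry_finishes:
  assumes s: "row_filled j b s" "nats s ''b'' 0 = b" and b: "b < M"
  shows "finishes oracle (M * (max_cost (relax W) + 12) + 30) (fill_entry W) s
    (\<lambda>t. row_filled j (Suc b) t \<and> nats t ''b'' 0 = b)"
proof -
  let ?I = "\<lambda>a t. row_filled j b t \<and> nats t ''b'' 0 = b \<and> entry_filled j b a t"
  let ?s = "set_nat ''P'' (Suc j * M + b) 0 s"
  have loop: "finishes oracle (M * (max_cost (relax W) + ncost (NVar ''M'') + 10) + ncost (NVar ''M'') + 7)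
      (For ''a'' (NVar ''M'') (relax W)) ?s (?I M)"
  proof (rule finishes_For)
    show "?I 0 ?s"
      using s b by (auto simp: row_filled_def filled_def ready_def bellman_table_def
          entry_filled_def row_upd bellman_entry_0 simp del: mult_Suc)
  qed (use relax_finishes b in \<open>auto simp: row_filled_def filled_def ready_def entry_filled_def\<close>)
  have first: "result oracle (NSet ''P'' next_entry_jb (NLit 0)) s = ?s"
    using s by (simp add: row_filled_def filled_def ready_def)
  have "finishes oracle (20 + (M * (max_cost (relax W) + 12) + 9)) (fill_entry W) s (?I M)"
    unfolding fill_entry_def
  proof (rule finishes_Seq_loop_free)
    show "finishes oracle (M * (max_cost (relax W) + 12) + 9) (For ''a'' (NVar ''M'') (relax W))
        (result oracle (NSet ''P'' next_entry_jb (NLit 0)) s) (?I M)"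
      unfolding first by (rule finishes_weaken[OF loop]) auto
  qed simp_all
  then show ?thesis
    by (rule finishes_weaken) (auto simp: row_filled_def less_Suc_eq)
qed

lemma fill_table_finishes:
  assumes s: "ready g s" "nats s ''P'' = (\<lambda>_. 0)" "reals s ''V'' = (\<lambda>_. 0)"
  shows "finishes oracle ((max_cost (relax W) + 100) * M * M * S) (fill_table W) s (filled S)"
proof -
  have M_pos: "1 \<le> M" by (simp add: M_def)
  let ?B = "M * (max_cost (relax W) + 12) + 30"
  have inner: "finishes oracle (M * (?B + ncost (NVar ''M'') + 10) + ncost (NVar ''M'') + 7)
      (For ''b'' (NVar ''M'') (fill_entry W)) t (row_filled j M)" if "filled j t" "nats t ''j'' 0 = j" for j t
  proof (rule finishes_For[where I = "row_filled j"])
    fix b u assume "b < M" "row_filled j b u" "nats u ''b'' 0 = b"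
    then show "finishes oracle ?B (fill_entry W) u (\<lambda>u. row_filled j (Suc b) u \<and> nats u ''b'' 0 = b)"
      by (intro fill_entry_finishes)
  qed (use that in \<open>auto simp: row_filled_def filled_def ready_def entry_filled_def\<close>)
  define B2 where "B2 = M * (?B + 12) + 9"
  let ?s = "set_nat ''P'' 0 1 s"
  have "row M 0 ((\<lambda>_. 0)(0 := Suc 0)) b = of_bool (b = 0)" if "b < M" for b
    using that M_pos by (simp add: row_eq)
  then have init: "filled 0 ?s"
    using s M_pos by (auto simp: filled_def ready_def bellman_table_def row_def)
  have loop: "finishes oracle (S * (B2 + ncost (NVar ''S'') + 10) + ncost (NVar ''S'') + 7)
      (For ''j'' (NVar ''S'') (For ''b'' (NVar ''M'') (fill_entry W))) ?s (filled S)"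
  proof (rule finishes_For[where I = filled])
    fix j t assume j: "j < S" and t: "filled j t" "nats t ''j'' 0 = j"
    show "finishes oracle B2 (For ''b'' (NVar ''M'') (fill_entry W)) t
        (\<lambda>t. filled (Suc j) t \<and> nats t ''j'' 0 = j)"
      by (rule finishes_weaken[OF inner[OF t]])
         (auto simp: B2_def row_filled_def filled_def bellman_table_def entry_filled_def less_Suc_eq)
  qed (use init in \<open>auto simp: filled_def ready_def\<close>)
  have "finishes oracle (10 + (S * (B2 + 12) + 9)) (fill_table W) s (filled S)"
    unfolding fill_table_def
    by (rule finishes_Seq_loop_free, simp, simp only: result.simps nval.simps,
        rule finishes_weaken[OF loop]) simp_all
  then show ?thesis
  proof (rule finishes_weaken)
    have 1: "?B + 12 \<le> M * (max_cost (relax W) + 54)"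
      using M_pos by (simp add: algebra_simps)
    have "B2 + 12 \<le> M * (M * (max_cost (relax W) + 54)) + M * 21"
      using mult_le_mono2[OF 1, of M] M_pos unfolding B2_def by linarith
    also have "\<dots> \<le> M * M * (max_cost (relax W) + 75)"
      using M_pos by (simp add: algebra_simps)
    finally have 2: "B2 + 12 \<le> M * M * (max_cost (relax W) + 75)" .
    have "S \<le> S * (M * M)" using M_pos by simp
    then have "10 + (S * (B2 + 12) + 9) \<le> S * (M * M * (max_cost (relax W) + 75)) + 19 * (S * (M * M))"
      using mult_le_mono2[OF 2, of S] S_pos by linarith
    also have "\<dots> \<le> (max_cost (relax W) + 100) * M * M * S"
      by (simp add: algebra_simps)
    finally show "10 + (S * (B2 + 12) + 9) \<le> (max_cost (relax W) + 100) * M * M * S" .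
  qed
qed

lemma read_off_finishes:
  assumes s: "filled S s" and reached: "0 < row M S (nats s ''P'') (M - 1)"
  defines "node \<equiv> trace_back (nats s ''P'') M S (M - 1)"
  shows "finishes oracle (200 * S) read_off s
    (\<lambda>t. (\<forall>j\<in>{1..S}. reals t ''y'' j = g (node (S - j)) \<and> reals t ''d'' j = tau_bar T D (reals t ''y'' j)) \<and>
       reals t ''y'' 0 = 0)"
proof -
  let ?P = "nats s ''P''"
  interpret bellman f C g M S "reals s ''V''" ?P "M - 1"
    using s f_mono S_pos g by unfold_locales (auto simp: filled_def covers_grid_def M_def)
  let ?I = "\<lambda>i t. ready g t \<and> nats t ''P'' = ?P \<and> nats t ''e'' 0 = node i \<and>
    (\<forall>j\<in>{S - i<..S}. reals t ''y'' j = g (node (S - j)) \<and> reals t ''d'' j = tau_bar T D (reals t ''y'' j))"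
  let ?s = "set_nat ''e'' 0 (M - 1) s"
  have loop: "finishes oracle (S * (100 + ncost (NVar ''S'') + 10) + ncost (NVar ''S'') + 7)
      (For ''i'' (NVar ''S'') trace_step) ?s (?I S)"
  proof (rule finishes_For[where I = ?I])
    show "?I 0 ?s" using s by (auto simp: filled_def ready_def node_def)
  next
    fix i t assume i: "i < S" and t: "?I i t" "nats t ''i'' 0 = i"
    have node: "node i < M"
      using node_reached[OF reached, of i] i by (simp add: node_def)
    have next_node: "node (Suc i) = ?P ((S - i) * M + node i) - 1"
      using node by (simp add: node_def row_eq)
    let ?t = "result oracle trace_step t"
    have res: "?t = set_nat ''e'' 0 (node (Suc i)) (set_real ''d'' (S - i) (tau_bar T D (g (node i)))
        (set_real ''y'' (S - i) (g (node i)) t))"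
      using t g_bounds[OF node] by (simp add: trace_step_def Let_def ready_def oracle_of_def next_node)
    have "{S - Suc i<..S} = insert (S - i) {S - i<..S}" "S - (S - i) = i"
      using i by auto
    then have "?I (Suc i) ?t"
      using t i unfolding res by (auto simp: ready_def)
    then show "finishes oracle 100 trace_step t (\<lambda>t. ?I (Suc i) t \<and> nats t ''i'' 0 = i)"
      using t by (intro finishes_loop_free) (auto simp: res, auto simp: trace_step_def Let_def)
  qed (auto simp: ready_def)
  have first: "result oracle (NAssign ''e'' (NSub (NVar ''M'') (NLit 1))) s = ?s"
    using s by (simp add: filled_def ready_def)
  have "finishes oracle (20 + (S * 112 + 9)) read_off s (?I S)"
    unfolding read_off_def
    by (rule finishes_Seq_loop_free, simp, unfold first, rule finishes_weaken[OF loop]) simp_all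
  then show ?thesis
    by (rule finishes_weaken) (use S_pos in \<open>auto simp: ready_def\<close>)
qed

end

text \<open>
  The path \<open>y\<close> in the hypotheses merely witnesses that the target can be reached inside the grid.
\<close>

lemma solver_finishes:
  assumes y: "load_path S C (D T) y" and on_grid: "\<And>j. j \<le> S \<Longrightarrow> y j \<in> grid C T D N"
  shows "finishes oracle ((max_cost (relax W) + 500) * M * M * S) (solver W) (input_store S C T 0 D)
    (\<lambda>t. load_path S C (D T) (reals t ''y'') \<and>
       (\<forall>j\<in>{1..S}. reals t ''d'' j = tau_bar T D (reals t ''y'' j)) \<and>
       (\<forall>y. load_path S C (D T) y \<and> (\<forall>j\<le>S. y j \<in> grid C T D N) \<longrightarrow>
          path_value f (reals t ''y'') S \<le> path_value f y S))"
    (is "finishes _ _ _ _ ?Q")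
proof -
  have read: "finishes oracle (200 * S) read_off s ?Q" if g: "covers_grid g" and s: "filled g S s" for g s
  proof -
    interpret bellman f C g M S "reals s ''V''" "nats s ''P''" "M - 1"
      using s f_mono S_pos g by unfold_locales (auto simp: filled_def covers_grid_def M_def)
    have g_end: "g (M - 1) = D T" using g by (simp add: covers_grid_def)
    have below: "0 < row M S (nats s ''P'') (M - 1) \<and> row M S (reals s ''V'') (M - 1) \<le> path_value f y S"
      if "load_path S C (D T) y" "\<And>j. j \<le> S \<Longrightarrow> y j \<in> grid C T D N" for y
      using that g by (intro table_le_path_value) (auto simp: covers_grid_def)
    then have reached: "0 < row M S (nats s ''P'') (M - 1)"
      using y on_grid by blast
    let ?node = "trace_back (nats s ''P'') M S (M - 1)"
    let ?z = "\<lambda>j. g (?node (S - j))"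
    show ?thesis
    proof (rule finishes_weaken[OF read_off_finishes[OF g s reached]])
      fix t :: store
      assume t: "(\<forall>j\<in>{1..S}. reals t ''y'' j = ?z j \<and> reals t ''d'' j = tau_bar T D (reals t ''y'' j)) \<and>
        reals t ''y'' 0 = 0"
      have eq: "reals t ''y'' j = ?z j" if "j \<le> S" for j
        using t that node_last[OF reached] g_0 by (cases "j = 0") auto
      have "load_path S C (D T) (reals t ''y'')"
        using trace_path[OF reached] eq unfolding load_path_def g_end by auto
      moreover have "path_value f (reals t ''y'') S = row M S (reals s ''V'') (M - 1)"
        using trace_value[OF reached, of S] path_value_cong[of S "reals t ''y''" ?z f] eq by simp
      ultimately show "?Q t"
        using t below by simp
    qed simp
  qed
  have fill: "finishes oracle ((max_cost (relax W) + 100) * M * M * S + 200 * S)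
      (Seq (fill_table W) read_off) s ?Q"
    if "covers_grid g \<and> ready g s \<and> nats s ''P'' = (\<lambda>_. 0) \<and> reals s ''V'' = (\<lambda>_. 0)" for g s
    by (rule finishes_Seq, rule finishes_weaken[OF fill_table_finishes[of g]]) (use that read in auto)
  have "unprocessed (input_store S C T 0 D)"
    using finite_discontinuities by (auto simp: unprocessed_def input_store_def Let_def)
  then have "finishes oracle (200 * M + ((max_cost (relax W) + 100) * M * M * S + 200 * S))
      (solver W) (input_store S C T 0 D) ?Q"
    unfolding solver_def
    by (intro finishes_Seq, intro finishes_weaken[OF make_grid_finishes])
       (use fill in \<open>auto simp: input_store_def Let_def\<close>)
  then show ?thesis
  proof (rule finishes_weaken)
    have "1 \<le> M" by (simp add: M_def)
    then have "1 \<le> M * S" "1 \<le> M * M" using S_pos by simp_all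
    then have "M \<le> M * M * S" "S \<le> M * M * S"
      using mult_le_mono2[of 1 "M * S" M] mult_le_mono1[of 1 "M * M" S]
      by (simp_all add: mult.assoc)
    then have "200 * M + ((max_cost (relax W) + 100) * M * M * S + 200 * S) \<le>
        (max_cost (relax W) + 100) * M * M * S + 400 * (M * M * S)"
      by linarith
    then show "200 * M + ((max_cost (relax W) + 100) * M * M * S + 200 * S) \<le>
        (max_cost (relax W) + 500) * M * M * S"
      by (simp add: algebra_simps)
  qed
qed

text \<open>
  The number of grid points is linear in the number of discontinuities, with a factor that depends
  on \<open>D T / C\<close> only. The factor \<open>max 1 K\<close> covers a continuous demand, where the grid still has points.
\<close>

lemma M_le: "M \<le> (3 * N + 5) * max 1 K"
proof -
  have "M = (K + 2) * Suc N + 2" by (simp add: M_def)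
  also have "\<dots> \<le> (3 * max 1 K) * Suc N + 2 * max 1 K"
    by (intro add_mono mult_right_mono) auto
  finally show ?thesis by (simp add: algebra_simps)
qed

text \<open>
  A monotone \<open>h\<close> translates path costs into objective values. On the path found the objective has to
  be at most the translated cost, whereas every feasible solution has to cost at least as much as its
  staircase; comparing the two through the grid gives optimality.
\<close>

lemma solver_computes_optimum:
  assumes feas: "\<exists>d y. feasible S C T 0 D d y"
    and h_mono: "\<And>v w. v \<le> w \<Longrightarrow> h v \<le> h w"
    and upper: "\<And>d y. load_path S C (D T) y \<Longrightarrow> (\<And>j. j \<in> {1..S} \<Longrightarrow> d j = tau_bar T D (y j)) \<Longrightarrow>
      obj S T D d y \<le> h (path_value f y S)"
    and lower: "\<And>d y. feasible S C T 0 D d y \<Longrightarrow>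
      h (path_value f (staircase C T D y) S) \<le> obj S T D d y"
  shows "computes_optimum_within (solver W) obj S C T 0 D
    ((max_cost (relax W) + 500) * (3 * N + 5)\<^sup>2 * (max 1 K)\<^sup>2 * S)"
proof -
  have stair: "load_path S C (D T) (staircase C T D y) \<and> (\<forall>j\<le>S. staircase C T D y j \<in> grid C T D N)"
    if "feasible S C T 0 D d y" for d y
    using feasible_load_path[OF that S_pos] C_pos N_loads_suffice
    by (auto intro: staircase_path staircase_in_grid)
  obtain d0 y0 where feas0: "feasible S C T 0 D d0 y0"
    using feas by blast
  note run = solver_finishes[OF conjunct1[OF stair[OF feas0]], unfolded finishes_def]
  obtain n t where exec: "exec oracle (solver W) (input_store S C T 0 D) n t"
    and n: "n \<le> (max_cost (relax W) + 500) * M * M * S"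
    and y: "load_path S C (D T) (reals t ''y'')"
    and d: "\<And>j. j \<in> {1..S} \<Longrightarrow> reals t ''d'' j = tau_bar T D (reals t ''y'' j)"
    and best: "\<And>y. load_path S C (D T) y \<and> (\<forall>j\<le>S. y j \<in> grid C T D N) \<Longrightarrow>
      path_value f (reals t ''y'') S \<le> path_value f y S"
    using run stair[OF feas0] by blast
  have "optimal obj S C T 0 D (reals t ''d'') (reals t ''y'')"
    unfolding optimal_def
  proof (intro conjI allI impI)
    show "feasible S C T 0 D (reals t ''d'') (reals t ''y'')"
      using y d by (rule load_path_feasible)
    fix d' y' assume feas': "feasible S C T 0 D d' y'"
    have "obj S T D (reals t ''d'') (reals t ''y'') \<le> h (path_value f (reals t ''y'') S)"
      using y d by (rule upper)
    also have "\<dots> \<le> h (path_value f (staircase C T D y') S)"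
      using best[OF stair[OF feas']] by (rule h_mono)
    also have "\<dots> \<le> obj S T D d' y'"
      using feas' by (rule lower)
    finally show "obj S T D (reals t ''d'') (reals t ''y'') \<le> obj S T D d' y'" .
  qed
  moreover have "n \<le> (max_cost (relax W) + 500) * (3 * N + 5)\<^sup>2 * (max 1 K)\<^sup>2 * S"
  proof -
    note n
    also have "(max_cost (relax W) + 500) * M * M * S = (max_cost (relax W) + 500) * M\<^sup>2 * S"
      by (simp add: power2_eq_square)
    also have "\<dots> \<le> (max_cost (relax W) + 500) * ((3 * N + 5) * max 1 K)\<^sup>2 * S"
      using M_le by (intro mult_right_mono mult_left_mono power_mono) auto
    also have "\<dots> = (max_cost (relax W) + 500) * (3 * N + 5)\<^sup>2 * (max 1 K)\<^sup>2 * S"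
      by (simp only: power_mult_distrib mult.assoc)
    finally show ?thesis .
  qed
  ultimately show ?thesis
    using exec unfolding computes_optimum_within_def by blast
qed

end


section \<open>The two problems\<close>

abbreviation entry_V :: rexp where "entry_V \<equiv> RGet ''V'' entry_ja"

definition ave_code :: com where
  "ave_code = RAssign ''cand''
     (RAdd entry_V (RMul (RSub (at_grid ''b'') (at_grid ''a'')) (QTauBar (at_grid ''b''))))"

definition max_code :: com where
  "max_code =
     Seq (RAssign ''cand'' (RSub (QTauBar (at_grid ''b'')) (QTau (at_grid ''a''))))
         (Cond (RLess (RVar ''cand'') entry_V) (RAssign ''cand'' entry_V) Skip)"

context shuttle_instance
begin

lemma ave_program: "shuttle_program T D S C (ave_step T D) ave_code"
  by unfold_locales (auto simp: ave_step_def ave_code_def oracle_of_def)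

lemma max_program: "shuttle_program T D S C (max_step T D) max_code"
  by unfold_locales (auto simp: max_step_def max_code_def oracle_of_def max_def)

lemma ave_solved:
  assumes "\<exists>d y. feasible S C T 0 D d y"
  shows "computes_optimum_within (solver ave_code) g_ave S C T 0 D
    ((max_cost (relax ave_code) + 500) * (3 * N + 5)\<^sup>2 * (max 1 K)\<^sup>2 * S)"
proof -
  interpret shuttle_program T D S C "ave_step T D" ave_code
    by (rule ave_program)
  show ?thesis
  proof (rule solver_computes_optimum[OF assms,
        where h = "\<lambda>v. (v - integral {0..D T} (tau_bar T D)) / D T"])
    fix d y assume "load_path S C (D T) y" "\<And>j. j \<in> {1..S} \<Longrightarrow> d j = tau_bar T D (y j)"
    then show "g_ave S T D d y \<le>
        (path_value (ave_step T D) y S - integral {0..D T} (tau_bar T D)) / D T"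
      by (simp add: g_ave_eq ave_path_value)
  next
    fix d y assume feas: "feasible S C T 0 D d y"
    show "(path_value (ave_step T D) (staircase C T D y) S - integral {0..D T} (tau_bar T D)) / D T
        \<le> g_ave S T D d y"
      unfolding g_ave_eq[OF feasible_load_path[OF feas S_pos]]
      using staircase_ave_value_le[OF feas S_pos] C_pos DT_pos
      by (intro divide_right_mono diff_right_mono) auto
  qed (use DT_pos in \<open>simp add: divide_right_mono\<close>)
qed

lemma max_solved:
  assumes "\<exists>d y. feasible S C T 0 D d y"
  shows "computes_optimum_within (solver max_code) g_max S C T 0 D
    ((max_cost (relax max_code) + 500) * (3 * N + 5)\<^sup>2 * (max 1 K)\<^sup>2 * S)"
proof -
  interpret shuttle_program T D S C "max_step T D" max_code
    by (rule max_program)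
  show ?thesis
    by (rule solver_computes_optimum[OF assms, where h = "\<lambda>v. v"])
       (use g_max_tau_bar_le staircase_max_value_le S_pos C_pos DT_pos in auto)
qed

end

text \<open>
  A positive demand can only be transported with positive capacity.
\<close>

lemma feasible_shuttle_instance:
  assumes "shuttle_data S C T 0 D" "step_function_on {0..T} D" and feas: "feasible S C T 0 D d y"
  shows "shuttle_instance T D S C"
proof -
  interpret step_demand T D
    using assms by unfold_locales (auto simp: shuttle_data_def)
  have pos: "S > 0" "D T > 0" using assms(1) by (auto simp: shuttle_data_def)
  obtain j where j: "j \<in> {1..S}" "y (j - 1) < y j"
    using some_shuttle_loaded[OF feasible_load_path[OF feas pos(1)] pos(2)] .
  have "y j - y (j - 1) \<le> C" using feas j(1) unfolding feasible_def by blast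
  with j(2) have "C > 0" by simp
  with pos show ?thesis by unfold_locales
qed

(* One program serves all inputs; the factor c hidden in the O-notation depends only on C, T
   and the total demand D T. Reading K as max 1 K makes the bound meaningful also for a demand
   without discontinuity, where K ^ 2 * S = 0. *)
theorem proposition4:
  shows "\<forall>g \<in> {g_max, g_ave}.
    \<exists>p. \<exists>c :: real \<Rightarrow> real \<Rightarrow> real \<Rightarrow> nat.
      \<forall>S C T \<nu> D K.
        shuttle_data S C T \<nu> D \<and>
        step_function_on {0..T} D \<and>
        K = card (discontinuities T D) \<and>
        \<nu> = 0 \<and>
        (\<exists>d y. feasible S C T \<nu> D d y)
        \<longrightarrow> computes_optimum_within p g S C T \<nu> D (c C T (D T) * (max 1 K)\<^sup>2 * S)"
proof
  fix g :: "nat \<Rightarrow> real \<Rightarrow> (real \<Rightarrow> real) \<Rightarrow> (nat \<Rightarrow> real) \<Rightarrow> (nat \<Rightarrow> real) \<Rightarrow> real"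
  assume g: "g \<in> {g_max, g_ave}"
  define W where "W = (if g = g_max then max_code else ave_code)"
  show "\<exists>p. \<exists>c :: real \<Rightarrow> real \<Rightarrow> real \<Rightarrow> nat.
      \<forall>S C T \<nu> D K.
        shuttle_data S C T \<nu> D \<and>
        step_function_on {0..T} D \<and>
        K = card (discontinuities T D) \<and>
        \<nu> = 0 \<and>
        (\<exists>d y. feasible S C T \<nu> D d y)
        \<longrightarrow> computes_optimum_within p g S C T \<nu> D (c C T (D T) * (max 1 K)\<^sup>2 * S)"
  proof (intro exI[of _ "solver W"] exI[of _
        "\<lambda>C T Y. (max_cost (relax W) + 500) * (3 * nat \<lceil>Y / C\<rceil> + 5)\<^sup>2"] allI impI)
    fix S C T \<nu> D and K :: nat
    assume A: "shuttle_data S C T \<nu> D \<and> step_function_on {0..T} D \<and>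
      K = card (discontinuities T D) \<and> \<nu> = 0 \<and> (\<exists>d y. feasible S C T \<nu> D d y)"
    then have feas: "\<exists>d y. feasible S C T 0 D d y" and K: "K = card (discontinuities T D)"
      and zero: "\<nu> = 0"
      by auto
    interpret shuttle_instance T D S C
      using A feasible_shuttle_instance by blast
    show "computes_optimum_within (solver W) g S C T \<nu> D
        ((max_cost (relax W) + 500) * (3 * nat \<lceil>D T / C\<rceil> + 5)\<^sup>2 * (max 1 K)\<^sup>2 * S)"
      using g max_solved[OF feas] ave_solved[OF feas]
      unfolding W_def K zero N_def by (cases "g = g_max") simp_all
  qed
qed

end
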